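(* Let $\beta\in C^1([0,+\infty))$ be (strictly) increasing with $\beta(0)=0$ and $\beta^\infty:=\lim_{r\to+\infty}\beta(r)<+\infty$. Let $V\in C^2(\mathbb R)$ and $\lambda\in\mathbb R$ satisfy $V''\ge\lambda$ on $\mathbb R$ and $\liminf_{|x|\to+\infty}V(x)/|x|^2\ge 0$. Suppose that $\lim_{|x|\to+\infty}V(x)=+\infty$ and that $\int_{\mathbb R\setminus\tilde Q}H(V(x)-V_{\min})\,dx<+\infty$ for some bounded open neighborhood $\tilde Q$ of $Q$. Let $\mathfrak m>0$. If $\mathfrak d<+\infty$, a measure $\rho=u\mathscr L^1+\rho^\perp\in\mathscr M_+^c(\mathbb R,\mathfrak m)$ satisfies $\mathcal I(\rho)=0$ if and only if it satisfies the following three conditions: 1. all the connected components $I\in\mathscr I(u)$ of the open set $\Omega_+(u)$ are admissible local sublevels of $V$; 2. $u|_I=H(V(x)-\mathfrak v_I)$ for every $I\in\mathscr I(u)$; 3. with $Q(u):=\bigcup_{I\in\mathscr I(u)}Q_I$, $\rho^\perp$ is concentrated on $Q(u)$ and $\mathfrak m=\sum_{I\in\mathscr I(u)}M_I+\rho^\perp(\mathbb R)$.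
   Context: $\mathscr M_+^c(\mathbb R,\mathfrak m)$ is the set of nonnegative Borel measures $\rho$ on $\mathbb R$ with mass $\mathfrak m$ and Lebesgue decomposition $\rho=u\mathscr L^1+\rho^\perp$ ($\mathscr L^1$ Lebesgue measure) such that the density has a representative $u\in C^0(\mathbb R;[0,+\infty])$ (with which $u$ is identified) with $\rho^\perp(\{u<+\infty\})=0$ and $\mathscr L^1(\{u=+\infty\})=0$. $\mathsf D_+(u):=\{0<u<+\infty\}$, $\beta(+\infty):=\beta^\infty$. For $\rho\in\mathscr M_+^c(\mathbb R,\mathfrak m)$: $\mathcal I(\rho):=\int_{\mathsf D_+(u)}|\frac{\partial_x\beta(u)}{u}+V'|^2u\,dx+\int_{\mathbb R}|V'|^2d\rho^\perp$ if $\beta\circ u\in W^{1,1}_{\rm loc}(\mathbb R)$, and $\mathcal I(\rho):=+\infty$ otherwise. $E(r):=-\beta(r)-r\int_r^{+\infty}\frac{\beta'(s)}s\,ds$, $E(0)=0$, $E'(r)=-\int_r^{+\infty}\frac{\beta'(s)}sds$. $V_{\min}:=\min_{\mathbb R}V$, $Q:=\{V=V_{\min}\}$. $\mathfrak d:=-\lim_{r\to0^+}E'(r)=\int_0^{+\infty}\frac{\beta'(s)}sds\in(0,+\infty]$. $H(v):=(E')^{-1}(-v)$ for $v\in(0,\mathfrak d)$, $H(v):=0$ if $\mathfrak d<+\infty$ and $v\ge\mathfrak d$, and by continuity $H(0):=+\infty$. For a continuous $u:\mathbb R\to[0,+\infty]$, $\Omega_+(u):=\{x:u(x)>0\}$ and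 $\mathscr I(u)$ is the collection of all connected components of $\Omega_+(u)$. When $\mathfrak d<+\infty$, a bounded open interval $I=(a,b)\subset\mathbb R$ is an admissible local sublevel of $V$ if $V(a)=V(b)$, $\mathfrak v_I:=V(a)-\mathfrak d\le V(x)<V(a)$ for every $x\in(a,b)$, and $M_I:=\int_a^bH(V(x)-\mathfrak v_I)\,dx<+\infty$. One sets $Q_I:=\{x\in I:V(x)=\min_IV\}$. *)

theory Defs
  imports "HOL-Analysis.Analysis"
begin

text \<open>\<open>cont_decomp \<rho> u \<rho>p\<close>: the Lebesgue decomposition of \<open>\<rho>\<close> is \<open>u\<close> times Lebesgue measure plus
  the singular part \<open>\<rho>p\<close>, where \<open>u\<close> is a continuous \<open>[0,\<infinity>]\<close>-valued representative of the density.
  Both \<open>u\<close> and \<open>\<rho>p\<close> are determined by \<open>\<rho>\<close> when \<open>\<rho>\<close> is finite.\<close>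

definition cont_decomp :: "real measure \<Rightarrow> (real \<Rightarrow> ennreal) \<Rightarrow> real measure \<Rightarrow> bool" where
  "cont_decomp \<rho> u \<rho>p \<longleftrightarrow>
     sets \<rho> = sets borel \<and> sets \<rho>p = sets borel \<and>
     (\<forall>A\<in>sets borel. emeasure \<rho> A = emeasure (density lborel u) A + emeasure \<rho>p A) \<and>
     (\<exists>N\<in>sets borel. emeasure lborel N = 0 \<and> emeasure \<rho>p (- N) = 0) \<and>
     continuous_on UNIV u \<and>
     emeasure \<rho>p {x. u x < \<infinity>} = 0 \<and>
     emeasure lborel {x. u x = \<infinity>} = 0"

definition M_plus_c :: "real \<Rightarrow> real measure set" where
  "M_plus_c m = {\<rho>. emeasure \<rho> UNIV = ennreal m \<and> (\<exists>u \<rho>p. cont_decomp \<rho> u \<rho>p)}"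

definition test_function :: "(real \<Rightarrow> real) \<Rightarrow> bool" where
  "test_function \<phi> \<longleftrightarrow>
     (\<forall>n x. (deriv ^^ n) \<phi> differentiable at x) \<and> compact (closure {x. \<phi> x \<noteq> 0})"

definition locally_integrable :: "(real \<Rightarrow> real) \<Rightarrow> bool" where
  "locally_integrable f \<longleftrightarrow> (\<forall>a b. set_integrable lborel {a..b} f)"

definition has_weak_deriv :: "(real \<Rightarrow> real) \<Rightarrow> (real \<Rightarrow> real) \<Rightarrow> bool" where
  "has_weak_deriv f g \<longleftrightarrow> locally_integrable g \<and>
     (\<forall>\<phi>. test_function \<phi> \<longrightarrow> (LBINT x. f x * deriv \<phi> x) = - (LBINT x. g x * \<phi> x))"

definition W11_loc :: "(real \<Rightarrow> real) set" where
  "W11_loc = {f. locally_integrable f \<and> (\<exists>g. has_weak_deriv f g)}"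

text \<open>Weak derivatives are unique up to Lebesgue null sets, so the choice is immaterial.\<close>

definition weak_deriv :: "(real \<Rightarrow> real) \<Rightarrow> real \<Rightarrow> real" where
  "weak_deriv f = (SOME g. has_weak_deriv f g)"

definition beta_ext :: "(real \<Rightarrow> real) \<Rightarrow> ennreal \<Rightarrow> real" where
  "beta_ext \<beta> r = (if r = \<infinity> then Lim at_top \<beta> else \<beta> (enn2real r))"

definition D_plus :: "(real \<Rightarrow> ennreal) \<Rightarrow> real set" where
  "D_plus u = {x. 0 < u x \<and> u x < \<infinity>}"

definition dissipation ::
  "(real \<Rightarrow> real) \<Rightarrow> (real \<Rightarrow> real) \<Rightarrow> (real \<Rightarrow> ennreal) \<Rightarrow> real measure \<Rightarrow> ennreal" where
  "dissipation \<beta> V u \<rho>p =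
     (if beta_ext \<beta> \<circ> u \<in> W11_loc
      then (\<integral>\<^sup>+x\<in>D_plus u.
              ennreal (\<bar>weak_deriv (beta_ext \<beta> \<circ> u) x / enn2real (u x) + deriv V x\<bar>\<^sup>2 * enn2real (u x))
            \<partial>lborel)
           + (\<integral>\<^sup>+x. ennreal (\<bar>deriv V x\<bar>\<^sup>2) \<partial>\<rho>p)
      else \<infinity>)"

text \<open>\<open>\<beta>\<close> is only meaningful on \<open>[0,\<infinity>)\<close>, and \<open>energy\<close> is only used there.\<close>

definition energy :: "(real \<Rightarrow> real) \<Rightarrow> real \<Rightarrow> real" where
  "energy \<beta> r = - \<beta> r - r * (LBINT s:{r<..}. deriv \<beta> s / s)"

definition dd :: "(real \<Rightarrow> real) \<Rightarrow> ereal" where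
  "dd \<beta> = - Lim (at_right 0) (\<lambda>r. ereal (deriv (energy \<beta>) r))"

text \<open>\<open>H 0 = \<infinity>\<close> is the continuous extension; negative arguments do not occur on admissible intervals.\<close>

definition H :: "(real \<Rightarrow> real) \<Rightarrow> real \<Rightarrow> ennreal" where
  "H \<beta> v = (if v \<le> 0 then \<infinity>
            else if ereal v < dd \<beta> then ennreal (inv_into {0<..} (deriv (energy \<beta>)) (- v))
            else 0)"

definition V_min :: "(real \<Rightarrow> real) \<Rightarrow> real" where
  "V_min V = (INF x. V x)"

definition Q_min :: "(real \<Rightarrow> real) \<Rightarrow> real set" where
  "Q_min V = {x. V x = V_min V}"

text \<open>For \<open>I = (a,b)\<close> we have \<open>Inf I = a\<close>, so \<open>v_level\<close> is \<open>V(a) - dd\<close>.\<close>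

definition v_level :: "(real \<Rightarrow> real) \<Rightarrow> (real \<Rightarrow> real) \<Rightarrow> real set \<Rightarrow> real" where
  "v_level \<beta> V I = V (Inf I) - real_of_ereal (dd \<beta>)"

definition M_level :: "(real \<Rightarrow> real) \<Rightarrow> (real \<Rightarrow> real) \<Rightarrow> real set \<Rightarrow> ennreal" where
  "M_level \<beta> V I = (\<integral>\<^sup>+x\<in>I. H \<beta> (V x - v_level \<beta> V I) \<partial>lborel)"

definition admissible_sublevel :: "(real \<Rightarrow> real) \<Rightarrow> (real \<Rightarrow> real) \<Rightarrow> real set \<Rightarrow> bool" where
  "admissible_sublevel \<beta> V I \<longleftrightarrow>
     (\<exists>a b. a < b \<and> I = {a<..<b} \<and> V a = V b \<and>
        (\<forall>x\<in>{a<..<b}. v_level \<beta> V I \<le> V x \<and> V x < V a)) \<and>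
     M_level \<beta> V I < \<infinity>"

definition Q_level :: "(real \<Rightarrow> real) \<Rightarrow> real set \<Rightarrow> real set" where
  "Q_level V I = {x\<in>I. V x = (INF y\<in>I. V y)}"

definition Omega_plus :: "(real \<Rightarrow> ennreal) \<Rightarrow> real set" where
  "Omega_plus u = {x. 0 < u x}"

end

theory Submission
  imports Defs "HOL-Computational_Algebra.Polynomial"
begin

text \<open>
  Write \<open>G r\<close> for the integral of \<open>\<beta>' s / s\<close> over \<open>s > r\<close>, so that \<open>E' = - G\<close>. Extended by \<open>G 0 = d\<close> and
  \<open>G \<infinity> = 0\<close>, it is a decreasing homeomorphism of \<open>[0, \<infinity>]\<close> onto \<open>[0, d]\<close> whose inverse is \<open>H\<close>. Formally
  \<open>\<partial>(\<beta> u) / u = - \<partial>(G u)\<close>, so that the dissipation vanishes exactly if \<open>V - G u\<close> has derivative zero where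
  \<open>0 < u < \<infinity>\<close> and \<open>V'\<close> vanishes almost everywhere with respect to the singular part.

  If the dissipation vanishes, then \<open>V - G u\<close> is constant on each component \<open>I\<close> of \<open>{u > 0}\<close>, although \<open>I\<close>
  may contain a Cantor set on which \<open>u = \<infinity>\<close>. Indeed the function is locally constant where
  \<open>0 < u < \<infinity>\<close>, hence takes countably many values there; on the null set \<open>{u = \<infinity>}\<close> it equals \<open>V\<close>, and a
  differentiable function maps null sets to null sets. So the image of the interval \<open>I\<close> is a connected null
  set, a single point \<open>c\<close> (\<open>level_constant_on_component\<close>). Coercivity of \<open>V\<close> makes \<open>I\<close> bounded, and
  continuity at its end points, where \<open>u = 0\<close> and hence \<open>G u = d\<close>, identifies \<open>c\<close> as the level of \<open>I\<close>
  (\<open>component_structure\<close>). The singular part lives on \<open>{u = \<infinity>} = {V = c}\<close>, where \<open>V\<close> is minimal on \<open>I\<close>, and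
  the mass formula is countable additivity over the components.

  Conversely, the explicit form of \<open>u\<close> gives the equation \<open>\<partial>(\<beta> u) = - V' u\<close> pointwise where \<open>0 < u < \<infinity>\<close>. It
  remains to see that no singular derivative hides in \<open>{u = 0}\<close> or \<open>{u = \<infinity>}\<close>. There \<open>\<beta> u\<close> has its extreme
  values, so truncating it slightly inside its range yields \<open>C\<^sup>1\<close> functions, for which integration by parts
  is elementary; the limit is taken by dominated convergence (\<open>has_weak_deriv_between_plateaus\<close>).

  Two technical points. Since \<open>\<beta>'\<close> may vanish, \<open>u\<close> need not be differentiable where \<open>\<beta> u\<close> is, and the
  relation between the derivatives of \<open>\<beta> u\<close> and \<open>G u\<close> is derived from difference quotients
  (\<open>DERIV_Gx_iff_DERIV_beta_ext\<close>). And a weak derivative is turned into increments of the function by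
  testing with smooth approximations of indicator functions of intervals
  (\<open>has_weak_deriv_imp_FTC\<close>).
\<close>

section \<open>Smooth step functions\<close>

text \<open>Smoothness is obtained coinductively: instead of computing iterated derivatives, exhibit a set of
  functions containing \<open>f\<close> in which every member has a derivative.\<close>

lemma test_functionI:
  assumes f: "f \<in> S"
    and step: "\<And>h. h \<in> S \<Longrightarrow> \<exists>h'\<in>S. \<forall>x. (h has_real_derivative h' x) (at x)"
    and supp: "\<And>x. x \<notin> {a..b} \<Longrightarrow> f x = 0"
  shows "test_function f"
proof -
  have mem: "(deriv ^^ n) f \<in> S" for n
  proof (induction n)
    case (Suc n)
    then obtain h' where h': "h' \<in> S" "\<And>x. ((deriv ^^ n) f has_real_derivative h' x) (at x)"
      using step by blast
    then have "deriv ((deriv ^^ n) f) = h'" by (auto intro!: ext DERIV_imp_deriv)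
    then show ?case using h'(1) by simp
  qed (use f in simp)
  have "(deriv ^^ n) f differentiable at x" for n x
    using step[OF mem[of n]] by (auto simp: real_differentiable_def)
  moreover have "closure {x. f x \<noteq> 0} \<subseteq> {a..b}"
    using supp by (intro closure_minimal) blast+
  then have "compact (closure {x. f x \<noteq> 0})"
    by (meson bounded_closed_interval bounded_subset closed_closure compact_eq_bounded_closed)
  ultimately show ?thesis by (auto simp: test_function_def)
qed

text \<open>For \<open>P = 1\<close> and \<open>k = 0\<close> this is the classical bump function on the unit interval; the additional rational
  factors make the family closed under differentiation.\<close>

definition bump :: "real poly \<Rightarrow> nat \<Rightarrow> real \<Rightarrow> real" where
  "bump P k x = (if 0 < x \<and> x < 1 then poly P x / (x * (1 - x)) ^ k * exp (- 1 / (x * (1 - x))) else 0)"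

lemma power_le_fact_exp:
  assumes "0 \<le> (t::real)"
  shows "t ^ n \<le> fact n * exp t"
proof -
  have "t ^ n / fact n \<le> exp t"
  proof -
    have s: "summable (\<lambda>n. t ^ n /\<^sub>R fact n)" by (rule summable_exp_generic)
    have "(\<Sum>i\<in>{n}. t ^ i /\<^sub>R fact i) \<le> (\<Sum>n. t ^ n /\<^sub>R fact n)"
      using assms by (intro sum_le_suminf s) auto
    then show ?thesis by (simp add: exp_def field_simps)
  qed
  then show ?thesis by (simp add: field_simps)
qed

text \<open>The exponential decay beats every negative power, so the family vanishes to second order at \<open>0\<close> and \<open>1\<close>.\<close>

lemma bump_bound: "\<exists>C. \<forall>x. \<bar>bump P k x\<bar> \<le> C * (x * (1 - x))\<^sup>2"
proof -
  have "compact (poly P ` {0..1})" by (intro compact_continuous_image continuous_intros) auto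
  then obtain B where B: "\<And>x. 0 \<le> x \<Longrightarrow> x \<le> 1 \<Longrightarrow> \<bar>poly P x\<bar> \<le> B"
    using bounded_iff[of "poly P ` {0..1}"] compact_imp_bounded by fastforce
  have B0: "B \<ge> 0" using B[of 0] by simp
  have "\<bar>bump P k x\<bar> \<le> B * fact (k + 2) * (x * (1 - x))\<^sup>2" for x
  proof (cases "0 < x \<and> x < 1")
    case True
    define q where "q = x * (1 - x)"
    have q: "q > 0" using True by (simp add: q_def)
    have "(1 / q) ^ (k + 2) \<le> fact (k + 2) * exp (1 / q)"
      using q by (intro power_le_fact_exp) simp
    then have "exp (- 1 / q) \<le> fact (k + 2) * q ^ (k + 2)"
      using q by (simp add: exp_minus field_simps del: fact_Suc)
    then have "exp (- 1 / q) / q ^ k \<le> fact (k + 2) * q ^ 2"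
      using q by (simp add: field_simps power_add power2_eq_square del: fact_Suc)
    then have "\<bar>poly P x\<bar> * (exp (- 1 / q) / q ^ k) \<le> B * (fact (k + 2) * q ^ 2)"
      using True q B0 by (intro mult_mono B) auto
    moreover have "\<bar>bump P k x\<bar> = \<bar>poly P x\<bar> * (exp (- 1 / q) / q ^ k)"
      using True q by (simp add: bump_def q_def[symmetric] abs_mult)
    ultimately show ?thesis by (simp add: q_def algebra_simps)
  qed (use B0 in \<open>auto simp: bump_def\<close>)
  then show ?thesis by blast
qed

text \<open>The derivative of \<open>P / q\<^sup>k exp (- 1 / q)\<close> over the common denominator \<open>q\<^sup>k\<^sup>+\<^sup>2\<close>, where \<open>A\<close>, \<open>B\<close>, \<open>D\<close> and
  \<open>e\<close> stand for the values of \<open>P'\<close>, \<open>P\<close>, \<open>q'\<close> and the exponential.\<close>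

lemma bump_quotient_rule:
  fixes q A B D e :: real
  assumes "q > 0"
  shows "(A * q ^ k - B * (real k * (q ^ (k - 1) * D))) / (q ^ k * q ^ k) * e + B / q ^ k * (e * (D / q\<^sup>2))
    = (A * q\<^sup>2 - real k * (B * D * q) + B * D) / q ^ (k + 2) * e"
proof (cases k)
  case 0
  have "A * e + B * (e * (D / (q * q))) = (A * (q * q) + B * D) / (q * q) * e"
    using assms by (simp add: add_divide_distrib distrib_right)
  with 0 show ?thesis by (simp add: power2_eq_square)
next
  case (Suc j)
  define p c where "p = q ^ j" and "c = real k"
  have p: "p > 0" using assms by (simp add: p_def)
  have "(A * (q * p) - B * (c * (p * D))) / ((q * p) * (q * p)) * e + B / (q * p) * (e * (D / (q * q)))
    = (A * (q * q) - c * (B * D * q) + B * D) / (q * q * (q * p)) * e"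
  proof -
    have 1: "(A * (q * p) - B * (c * (p * D))) / ((q * p) * (q * p))
        = (A * (q * q) - c * (B * D * q)) / (q * q * (q * p))"
      using p assms by (simp add: frac_eq_eq) algebra
    have 2: "B / (q * p) * (e * (D / (q * q))) = B * D / (q * q * (q * p)) * e"
      by (simp add: mult_ac)
    show ?thesis unfolding 1 2 add_divide_distrib by (simp add: algebra_simps)
  qed
  then show ?thesis
    by (simp add: Suc p_def c_def power2_eq_square mult.assoc)
qed

lemma bump_has_derivative:
  "\<exists>Q l. \<forall>x. (bump P k has_real_derivative bump Q l x) (at x)"
proof -
  define R :: "real poly" where "R = [:0, 1, -1:]"
  \<comment> \<open>Chosen to match the numerator in \<open>bump_quotient_rule\<close>.\<close>
  define Q where "Q = pderiv P * R\<^sup>2 - smult (real k) (P * pderiv R * R) + P * pderiv R"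
  have R: "poly R x = x * (1 - x)" "poly (pderiv R) x = 1 - 2 * x" for x
    by (simp_all add: R_def pderiv_pCons algebra_simps)
  have "(bump P k has_real_derivative bump Q (k + 2) x) (at x)" for x
  proof (cases "0 < x \<and> x < 1")
    case True
    define q where "q = x * (1 - x)"
    have q: "q > 0" using True by (simp add: q_def)
    have Rq: "poly R x = q" by (simp add: R(1) q_def)
    have nz: "poly R x \<noteq> 0" using q by (simp add: Rq)
    have "((\<lambda>x. poly P x / (poly R x) ^ k * exp (- 1 / poly R x)) has_real_derivative
        ((poly (pderiv P) x * poly R x ^ k - poly P x * (real k * (poly R x ^ (k - 1) * poly (pderiv R) x)))
          / (poly R x ^ k * poly R x ^ k) * exp (- 1 / poly R x)
         + poly P x / (poly R x) ^ k * (exp (- 1 / poly R x) * (poly (pderiv R) x / (poly R x)\<^sup>2)))) (at x)"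
    proof -
      have "((\<lambda>x. poly R x ^ k) has_real_derivative real k * (poly R x ^ (k - 1) * poly (pderiv R) x)) (at x)"
        by (rule DERIV_cong[OF DERIV_power[OF poly_DERIV]]) simp
      moreover have "((\<lambda>x. - 1 / poly R x) has_real_derivative poly (pderiv R) x / (poly R x)\<^sup>2) (at x)"
        by (rule DERIV_cong[OF DERIV_divide[OF DERIV_const poly_DERIV nz]]) (simp add: power2_eq_square)
      ultimately show ?thesis
        using nz by (intro DERIV_cong[OF DERIV_mult[OF DERIV_divide[OF poly_DERIV] DERIV_chain2[OF DERIV_exp]]])
          (auto simp: mult.commute)
    qed
    also have "((poly (pderiv P) x * poly R x ^ k - poly P x * (real k * (poly R x ^ (k - 1) * poly (pderiv R) x)))
          / (poly R x ^ k * poly R x ^ k) * exp (- 1 / poly R x)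
         + poly P x / (poly R x) ^ k * (exp (- 1 / poly R x) * (poly (pderiv R) x / (poly R x)\<^sup>2)))
        = poly Q x / (poly R x) ^ (k + 2) * exp (- 1 / poly R x)"
      unfolding Rq bump_quotient_rule[OF q] by (simp add: Q_def Rq)
    also have "\<dots> = bump Q (k + 2) x" using True by (simp add: bump_def R(1))
    finally show ?thesis
      by (rule has_field_derivative_transform_within_open[where S = "{0<..<1}"])
        (use True in \<open>auto simp: bump_def R(1)\<close>)
  next
    case False
    obtain C where C: "\<And>y. \<bar>bump P k y\<bar> \<le> C * (y * (1 - y))\<^sup>2" using bump_bound by blast
    have C0: "C \<ge> 0" using C[of 2] by (simp add: bump_def)
    \<comment> \<open>Outside the open unit interval the difference quotient is bounded by a multiple of the increment.\<close>
    have "\<bar>bump P k y / (y - x)\<bar> \<le> C * \<bar>y - x\<bar>" if "y \<noteq> x" for y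
    proof (cases "0 < y \<and> y < 1")
      case True
      have "(y * (1 - y))\<^sup>2 \<le> \<bar>y - x\<bar>\<^sup>2"
      proof (cases "x \<le> 0")
        case True
        then have "y * (1 - y) \<le> \<bar>y - x\<bar> * 1" using \<open>0 < y \<and> y < 1\<close> by (intro mult_mono) auto
        then show ?thesis using \<open>0 < y \<and> y < 1\<close> by (intro power_mono) auto
      next
        case False
        then have "y * (1 - y) \<le> 1 * \<bar>y - x\<bar>" using \<open>\<not> (0 < x \<and> x < 1)\<close> \<open>0 < y \<and> y < 1\<close>
          by (intro mult_mono) auto
        then show ?thesis using \<open>0 < y \<and> y < 1\<close> by (intro power_mono) auto
      qed
      then have "\<bar>bump P k y\<bar> \<le> C * \<bar>y - x\<bar>\<^sup>2"
        using C[of y] mult_left_mono[OF _ C0] by (meson order_trans)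
      then show ?thesis using that by (simp add: field_simps power2_eq_square)
    qed (auto simp: bump_def C0)
    then have "eventually (\<lambda>y. norm (bump P k y / (y - x)) \<le> C * \<bar>y - x\<bar>) (at x)"
      by (simp add: eventually_at_filter)
    moreover have "((\<lambda>y. C * \<bar>y - x\<bar>) \<longlongrightarrow> 0) (at x)"
    proof -
      have "isCont (\<lambda>y. C * \<bar>y - x\<bar>) x" by (intro continuous_intros)
      then show ?thesis by (simp add: isCont_def)
    qed
    ultimately have "((\<lambda>y. bump P k y / (y - x)) \<longlongrightarrow> 0) (at x)"
      by (rule Lim_null_comparison)
    moreover have "bump P k x = 0" "bump Q (k + 2) x = 0" using False by (auto simp: bump_def)
    ultimately show ?thesis by (simp add: has_field_derivative_iff)
  qed
  then show ?thesis by blast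
qed

text \<open>A smooth function that is \<open>0\<close> up to \<open>0\<close> and constant from \<open>1\<close> on. The constant is not normalised to \<open>1\<close>,
  because it cancels in the end. Starting the integral at \<open>-1\<close> rather than at \<open>0\<close> makes \<open>0\<close> an interior
  point of the domain of integration.\<close>

definition smooth_step :: "real \<Rightarrow> real" where
  "smooth_step x = integral {-1..x} (bump 1 0)"

lemma continuous_on_bump: "continuous_on A (bump P k)"
  using bump_has_derivative[of P k]
  by (meson DERIV_isCont continuous_at_imp_continuous_on)

lemma bump_nonneg: "0 \<le> bump 1 0 x"
  by (simp add: bump_def)

lemma smooth_step_has_derivative: "(smooth_step has_real_derivative bump 1 0 x) (at x)"
proof (cases "x > -1")
  case True
  have "((\<lambda>x. integral {-1..x} (bump 1 0)) has_real_derivative bump 1 0 x) (at x within {-1..x + 1})"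
    using True by (intro integral_has_real_derivative continuous_on_bump) auto
  moreover have "at x within {-1..x+1} = at x" using True by (intro at_within_interior) auto
  ultimately show ?thesis unfolding smooth_step_def[abs_def] by simp
next
  case False
  have z: "smooth_step y = 0" if "y < 0" for y
    unfolding smooth_step_def using that by (intro integral_unique has_integral_is_0) (auto simp: bump_def)
  have "((\<lambda>_. 0) has_real_derivative bump 1 0 x) (at x)" using False by (simp add: bump_def)
  then show ?thesis
    by (rule has_field_derivative_transform_within_open[where S = "{..<0}"])
      (use False z in auto)
qed

lemma smooth_step_le_0: "x \<le> 0 \<Longrightarrow> smooth_step x = 0"
  unfolding smooth_step_def by (intro integral_unique has_integral_is_0) (auto simp: bump_def)

lemma smooth_step_ge_1: 
  assumes "x \<ge> 1" shows "smooth_step x = smooth_step 1"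
proof -
  have "bump 1 0 integrable_on {-1..x}" by (intro integrable_continuous_interval continuous_on_bump)
  then have "smooth_step x = smooth_step 1 + integral {1..x} (bump 1 0)"
    unfolding smooth_step_def using assms by (simp add: Henstock_Kurzweil_Integration.integral_combine)
  moreover have "integral {1..x} (bump 1 0) = 0" by (intro integral_unique has_integral_is_0) (auto simp: bump_def)
  ultimately show ?thesis by simp
qed

lemma mono_smooth_step: "x \<le> y \<Longrightarrow> smooth_step x \<le> smooth_step y"
  by (rule DERIV_nonneg_imp_nondecreasing) (use smooth_step_has_derivative bump_nonneg in blast)+

lemma smooth_step_1_pos: "smooth_step 1 > 0"
proof -
  have "smooth_step 0 < smooth_step 1"
  proof (rule DERIV_pos_imp_increasing_open[where f = smooth_step])
    show "\<exists>y. (smooth_step has_real_derivative y) (at x) \<and> 0 < y" if "0 < x" "x < 1" for x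
      using smooth_step_has_derivative[of x] that by (intro exI[of _ "bump 1 0 x"]) (auto simp: bump_def)
    show "continuous_on {0..1} smooth_step"
      using smooth_step_has_derivative by (meson DERIV_isCont continuous_at_imp_continuous_on)
  qed simp
  then show ?thesis by (simp add: smooth_step_le_0)
qed

text \<open>Up to a constant factor these functions approximate the indicator function of an interval, and their
  derivatives approximate the difference of point masses at the end points.\<close>

lemma plateau_test_function:
  assumes "a \<le> b" "n > 0"
  shows "test_function (\<lambda>x. smooth_step (n * (x - a)) - smooth_step (n * (x - b)))" (is "test_function ?\<phi>")
proof (rule test_functionI)
  let ?S = "{\<lambda>x. c * bump P k (n * (x - a)) - c * bump P k (n * (x - b)) | c P k. True}"
  show "?\<phi> \<in> insert ?\<phi> ?S" by simp
  show "\<exists>h'\<in>insert ?\<phi> ?S. \<forall>x. (h has_real_derivative h' x) (at x)" if "h \<in> insert ?\<phi> ?S" for h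
    using that
  proof
    assume h: "h = ?\<phi>"
    have "(h has_real_derivative n * bump 1 0 (n * (x - a)) - n * bump 1 0 (n * (x - b))) (at x)" for x
      unfolding h by (auto intro!: derivative_eq_intros DERIV_chain2[OF smooth_step_has_derivative])
    moreover have "(\<lambda>x. n * bump 1 0 (n * (x - a)) - n * bump 1 0 (n * (x - b))) \<in> insert ?\<phi> ?S" by blast
    ultimately show ?thesis by (rule_tac bexI) auto
  next
    assume "h \<in> ?S"
    then obtain c P k where h: "h = (\<lambda>x. c * bump P k (n * (x - a)) - c * bump P k (n * (x - b)))" by blast
    obtain Q l where Q: "\<And>x. (bump P k has_real_derivative bump Q l x) (at x)"
      using bump_has_derivative by blast
    have "(h has_real_derivative (c * n) * bump Q l (n * (x - a)) - (c * n) * bump Q l (n * (x - b))) (at x)" for x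
      unfolding h by (auto intro!: derivative_eq_intros DERIV_chain2[OF Q] simp: algebra_simps)
    moreover have "(\<lambda>x. (c * n) * bump Q l (n * (x - a)) - (c * n) * bump Q l (n * (x - b))) \<in> insert ?\<phi> ?S" by blast
    ultimately show ?thesis by (rule_tac bexI) auto
  qed
  show "?\<phi> x = 0" if "x \<notin> {a..b + 1 / n}" for x
  proof (cases "x < a")
    case True
    then have "n * (x - a) \<le> 0" "n * (x - b) \<le> 0" using assms by (auto intro!: mult_nonneg_nonpos)
    then show ?thesis by (simp add: smooth_step_le_0)
  next
    case False
    then have "x > b + 1 / n" using that by auto
    then have "n * (x - b) \<ge> 1" using assms by (simp add: field_simps)
    moreover have "n * (x - a) \<ge> n * (x - b)" using assms by (intro mult_left_mono) auto
    ultimately show ?thesis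
      using smooth_step_ge_1[of "n * (x - a)"] smooth_step_ge_1[of "n * (x - b)"] by simp
  qed
qed

section \<open>Weak derivatives of continuous functions\<close>

lemma smooth_step_bounds: "0 \<le> smooth_step x" "smooth_step x \<le> smooth_step 1"
  using mono_smooth_step[of 0 x] mono_smooth_step[of x 1] smooth_step_le_0[of x] smooth_step_le_0[of 0]
    smooth_step_ge_1[of x]
  by linarith+

lemma integrable_compact_support:
  fixes f :: "real \<Rightarrow> real"
  assumes "continuous_on UNIV f" "\<And>x. x \<notin> {a..b} \<Longrightarrow> f x = 0"
  shows "integrable lborel f"
proof -
  have "set_integrable lborel {a..b} f"
    by (intro borel_integrable_atLeastAtMost' continuous_on_subset[OF assms(1)]) auto
  moreover have "(\<lambda>x. indicator {a..b} x *\<^sub>R f x) = f"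
    using assms(2) by (fastforce simp: indicator_def)
  ultimately show ?thesis by (simp add: set_integrable_def)
qed

lemma integral_bump: "(LBINT x. bump 1 0 x) = smooth_step 1"
proof -
  have "set_integrable lborel {-1..1} (bump 1 0)"
    by (intro borel_integrable_atLeastAtMost' continuous_on_bump)
  then have "(LBINT x:{-1..1}. bump 1 0 x) = smooth_step 1"
    unfolding smooth_step_def by (rule set_borel_integral_eq_integral)
  moreover have "(\<lambda>x. indicator {-1..1} x *\<^sub>R bump 1 0 x) = bump 1 0"
    by (auto simp: bump_def indicator_def)
  ultimately show ?thesis by (simp add: set_lebesgue_integral_def)
qed

text \<open>The substitution \<open>t = n (x - c)\<close> turns the integral into a weighted mean of \<open>f\<close> over
  \<open>[c, c + 1 / n]\<close>.\<close>

lemma bump_approximates_point: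
  fixes f :: "real \<Rightarrow> real"
  assumes f: "continuous_on UNIV f"
  shows "(\<lambda>n. LBINT x. f x * (real (Suc n) * bump 1 0 (real (Suc n) * (x - c)))) \<longlonglongrightarrow> f c * smooth_step 1"
proof -
  have eq: "(LBINT x. f x * (real (Suc n) * bump 1 0 (real (Suc n) * (x - c)))) = (LBINT t. f (c + t / real (Suc n)) * bump 1 0 t)" for n
  proof -
    have "(LBINT x. f x * (real (Suc n) * bump 1 0 (real (Suc n) * (x - c)))) =
      \<bar>1 / real (Suc n)\<bar> *\<^sub>R (LBINT t. f (c + 1 / real (Suc n) * t) * (real (Suc n) * bump 1 0 (real (Suc n) * (c + 1 / real (Suc n) * t - c))))"
      by (rule lborel_integral_real_affine) simp
    also have "\<dots> = (LBINT t. f (c + t / real (Suc n)) * bump 1 0 t)"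
      unfolding real_scaleR_def integral_mult_right_zero[symmetric]
    proof (rule Bochner_Integration.integral_cong[OF refl])
      fix t
      have "real (Suc n) * (c + 1 / real (Suc n) * t - c) = t" by (simp del: of_nat_Suc)
      then show "\<bar>1 / real (Suc n)\<bar> * (f (c + 1 / real (Suc n) * t) * (real (Suc n) * bump 1 0 (real (Suc n) * (c + 1 / real (Suc n) * t - c))))
          = f (c + t / real (Suc n)) * bump 1 0 t"
        by (simp del: of_nat_Suc)
    qed
    finally show ?thesis .
  qed
  have "compact (f ` {c..c + 1})" by (intro compact_continuous_image continuous_on_subset[OF f]) auto
  then obtain B where B: "\<And>x. c \<le> x \<Longrightarrow> x \<le> c + 1 \<Longrightarrow> \<bar>f x\<bar> \<le> B"
    using bounded_iff[of "f ` {c..c + 1}"] compact_imp_bounded by fastforce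
  have "(\<lambda>n. LBINT t. f (c + t / real (Suc n)) * bump 1 0 t) \<longlonglongrightarrow> (LBINT t. f c * bump 1 0 t)"
  proof (rule integral_dominated_convergence)
    have [measurable]: "f \<in> borel_measurable borel" "bump 1 0 \<in> borel_measurable borel"
      using f continuous_on_bump by (auto intro: borel_measurable_continuous_onI)
    show "(\<lambda>t. f c * bump 1 0 t) \<in> borel_measurable lborel" by measurable
    show "(\<lambda>t. f (c + t / real (Suc n)) * bump 1 0 t) \<in> borel_measurable lborel" for n by measurable
    show "integrable lborel (\<lambda>t. B * bump 1 0 t)"
      by (rule integrable_compact_support[where a = 0 and b = 1], intro continuous_intros continuous_on_bump) (auto simp: bump_def)
    show "AE t in lborel. (\<lambda>n. f (c + t / real (Suc n)) * bump 1 0 t) \<longlonglongrightarrow> f c * bump 1 0 t"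
    proof (rule AE_I2)
      fix t
      have "(\<lambda>n. c + t * inverse (real (Suc n))) \<longlonglongrightarrow> c + t * 0"
        by (intro tendsto_intros LIMSEQ_inverse_real_of_nat)
      moreover have "isCont f c" using f by (simp add: continuous_on_eq_continuous_at)
      ultimately have "(\<lambda>n. f (c + t / real (Suc n))) \<longlonglongrightarrow> f c"
        unfolding divide_inverse by (intro isCont_tendsto_compose[of c f]) (simp_all del: of_nat_Suc)
      then show "(\<lambda>n. f (c + t / real (Suc n)) * bump 1 0 t) \<longlonglongrightarrow> f c * bump 1 0 t"
        by (intro tendsto_intros)
    qed
    show "AE t in lborel. norm (f (c + t / real (Suc n)) * bump 1 0 t) \<le> B * bump 1 0 t" for n
    proof (rule AE_I2)
      fix t
      show "norm (f (c + t / real (Suc n)) * bump 1 0 t) \<le> B * bump 1 0 t"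
      proof (cases "0 < t \<and> t < 1")
        case True
        then have "t / real (Suc n) \<le> 1" by (simp add: divide_le_eq)
        then have "\<bar>f (c + t / real (Suc n))\<bar> \<le> B" using True by (intro B) auto
        then show ?thesis using bump_nonneg[of t] by (simp add: abs_mult mult_right_mono)
      qed (auto simp: bump_def)
    qed
  qed
  then show ?thesis by (simp only: eq integral_mult_right_zero integral_bump)
qed

lemma plateau_LIMSEQ:
  assumes "a \<le> b"
  shows "(\<lambda>n. smooth_step (real (Suc n) * (x - a)) - smooth_step (real (Suc n) * (x - b)))
    \<longlonglongrightarrow> smooth_step 1 * indicator {a<..b} x"
proof -
  have *: "(\<lambda>n. smooth_step (real (Suc n) * y)) \<longlonglongrightarrow> smooth_step 1 * indicator {0<..} y" for y
  proof (cases "y > 0")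
    case True
    then obtain N where N: "1 < real (Suc N) * y"
      using ex_less_of_nat_mult[of y 1] by (metis less_trans of_nat_less_iff lessI mult_less_cancel_right_pos)
    have "eventually (\<lambda>n. smooth_step (real (Suc n) * y) = smooth_step 1) sequentially"
      using eventually_ge_at_top[of N]
    proof eventually_elim
      case (elim n)
      then have "real (Suc N) * y \<le> real (Suc n) * y" using True by (intro mult_right_mono) auto
      then show ?case using N by (intro smooth_step_ge_1) auto
    qed
    then show ?thesis using True by (simp add: tendsto_eventually)
  next
    case False
    then show ?thesis by (simp add: smooth_step_le_0 mult_nonneg_nonpos)
  qed
  have "(\<lambda>n. smooth_step (real (Suc n) * (x - a)) - smooth_step (real (Suc n) * (x - b)))
    \<longlonglongrightarrow> smooth_step 1 * indicator {0<..} (x - a) - smooth_step 1 * indicator {0<..} (x - b)"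
    by (intro tendsto_diff *)
  also have "smooth_step 1 * indicator {0<..} (x - a) - smooth_step 1 * indicator {0<..} (x - b)
    = smooth_step 1 * indicator {a<..b} x"
    using assms by (auto simp: indicator_def)
  finally show ?thesis .
qed

lemma locally_integrable_measurable:
  assumes "locally_integrable g"
  shows "g \<in> borel_measurable borel"
proof (rule borel_measurable_LIMSEQ_real)
  show "(\<lambda>n. indicator {- real n..real n} x *\<^sub>R g x) \<longlonglongrightarrow> g x" for x
  proof (rule tendsto_eventually)
    obtain N where N: "\<bar>x\<bar> \<le> real N" using real_arch_simple by blast
    show "\<forall>\<^sub>F n in sequentially. indicator {- real n..real n} x *\<^sub>R g x = g x"
      using eventually_ge_at_top[of N] by eventually_elim (use N in \<open>auto simp: indicator_def\<close>)
  qed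
  show "(\<lambda>x. indicator {- real n..real n} x *\<^sub>R g x) \<in> borel_measurable borel" for n
  proof -
    have "integrable lborel (\<lambda>x. indicator {- real n..real n} x *\<^sub>R g x)"
      using assms by (simp add: locally_integrable_def set_integrable_def)
    then show ?thesis by (auto dest: borel_measurable_integrable)
  qed
qed

text \<open>Testing with plateaus over \<open>[a, b]\<close> that become steeper and steeper, the term with \<open>f\<close> tends to the
  difference of its values at \<open>a\<close> and \<open>b\<close>, and the term with \<open>g\<close> to its integral.\<close>

lemma has_weak_deriv_imp_FTC:
  assumes f: "continuous_on UNIV f" and wd: "has_weak_deriv f g" and ab: "a \<le> b"
  shows "(LBINT x:{a..b}. g x) = f b - f a"
proof -
  let ?N = "\<lambda>n. real (Suc n)"
  define \<phi> where "\<phi> n x = smooth_step (?N n * (x - a)) - smooth_step (?N n * (x - b))" for n x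
  have g: "set_integrable lborel {p..q} g" for p q
    using wd by (simp add: has_weak_deriv_def locally_integrable_def)
  have D\<phi>: "(\<phi> n has_real_derivative ?N n * bump 1 0 (?N n * (x - a)) - ?N n * bump 1 0 (?N n * (x - b))) (at x)" for n x
    unfolding \<phi>_def by (auto intro!: derivative_eq_intros DERIV_chain2[OF smooth_step_has_derivative])
  then have d\<phi>: "deriv (\<phi> n) x = ?N n * bump 1 0 (?N n * (x - a)) - ?N n * bump 1 0 (?N n * (x - b))" for n x
    by (rule DERIV_imp_deriv)
  have int: "integrable lborel (\<lambda>x. f x * (?N n * bump 1 0 (?N n * (x - c))))" for n c
  proof (rule integrable_compact_support)
    show "continuous_on UNIV (\<lambda>x. f x * (?N n * bump 1 0 (?N n * (x - c))))"
      by (intro continuous_intros f continuous_on_compose2[OF continuous_on_bump[of UNIV]]) auto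
    show "f x * (?N n * bump 1 0 (?N n * (x - c))) = 0" if "x \<notin> {c..c+1}" for x
    proof (cases "x < c")
      case True
      then have "?N n * (x - c) \<le> 0" by (intro mult_nonneg_nonpos) auto
      then show ?thesis by (simp add: bump_def)
    next
      case False
      then have "1 * 1 \<le> ?N n * (x - c)" using that by (intro mult_mono) auto
      then show ?thesis by (simp add: bump_def)
    qed
  qed
  have "(\<lambda>n. (LBINT x. f x * (?N n * bump 1 0 (?N n * (x - a)))) - (LBINT x. f x * (?N n * bump 1 0 (?N n * (x - b)))))
     \<longlonglongrightarrow> f a * smooth_step 1 - f b * smooth_step 1"
    by (intro tendsto_diff bump_approximates_point f)
  moreover have "(LBINT x. f x * (?N n * bump 1 0 (?N n * (x - a)))) - (LBINT x. f x * (?N n * bump 1 0 (?N n * (x - b))))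
     = - (LBINT x. g x * \<phi> n x)" for n
  proof -
    have "test_function (\<phi> n)" unfolding \<phi>_def using ab by (intro plateau_test_function) auto
    then have "(LBINT x. f x * deriv (\<phi> n) x) = - (LBINT x. g x * \<phi> n x)"
      using wd by (auto simp: has_weak_deriv_def)
    moreover have "(LBINT x. f x * deriv (\<phi> n) x) =
      (LBINT x. f x * (?N n * bump 1 0 (?N n * (x - a)))) - (LBINT x. f x * (?N n * bump 1 0 (?N n * (x - b))))"
      unfolding d\<phi> by (subst Bochner_Integration.integral_diff[OF int int, symmetric]) (simp add: right_diff_distrib)
    ultimately show ?thesis by simp
  qed
  ultimately have lhs: "(\<lambda>n. - (LBINT x. g x * \<phi> n x)) \<longlonglongrightarrow> f a * smooth_step 1 - f b * smooth_step 1"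
    by simp
  have \<phi>0: "\<phi> n x = 0" if "x \<notin> {a..b + 1}" for n x
  proof (cases "x < a")
    case True
    then have "?N n * (x - a) \<le> 0" "?N n * (x - b) \<le> 0" using ab by (auto intro!: mult_nonneg_nonpos)
    then show ?thesis by (simp add: \<phi>_def smooth_step_le_0)
  next
    case False
    then have "1 * 1 \<le> ?N n * (x - b)" using that by (intro mult_mono) auto
    moreover have "?N n * (x - b) \<le> ?N n * (x - a)" using ab by (intro mult_left_mono) auto
    ultimately have "1 \<le> ?N n * (x - b)" "1 \<le> ?N n * (x - a)" by linarith+
    then show ?thesis
      using smooth_step_ge_1[of "?N n * (x - a)"] smooth_step_ge_1[of "?N n * (x - b)"]
      by (simp add: \<phi>_def del: of_nat_Suc)
  qed
  have meas: "g \<in> borel_measurable borel"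
    using wd by (intro locally_integrable_measurable) (simp add: has_weak_deriv_def)
  have "(\<lambda>n. LBINT x. g x * \<phi> n x) \<longlonglongrightarrow> (LBINT x. g x * (smooth_step 1 * indicator {a<..b} x))"
  proof (rule integral_dominated_convergence)
    have "continuous_on UNIV (\<phi> n)" for n
      by (intro continuous_at_imp_continuous_on ballI DERIV_isCont[OF D\<phi>])
    then have [measurable]: "\<phi> n \<in> borel_measurable borel" for n by (rule borel_measurable_continuous_onI)
    note meas[measurable]
    show "(\<lambda>x. g x * (smooth_step 1 * indicator {a<..b} x)) \<in> borel_measurable lborel" by measurable
    show "(\<lambda>x. g x * \<phi> n x) \<in> borel_measurable lborel" for n by measurable
    show "integrable lborel (\<lambda>x. smooth_step 1 * \<bar>indicator {a..b + 1} x *\<^sub>R g x\<bar>)"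
      using g[of a "b + 1"] unfolding set_integrable_def by (intro integrable_mult_right integrable_abs)
    show "AE x in lborel. (\<lambda>n. g x * \<phi> n x) \<longlonglongrightarrow> g x * (smooth_step 1 * indicator {a<..b} x)"
      unfolding \<phi>_def by (intro AE_I2 tendsto_mult tendsto_const plateau_LIMSEQ ab)
    show "AE x in lborel. norm (g x * \<phi> n x) \<le> smooth_step 1 * \<bar>indicator {a..b + 1} x *\<^sub>R g x\<bar>" for n
    proof (rule AE_I2)
      fix x
      have "\<bar>\<phi> n x\<bar> \<le> smooth_step 1"
        unfolding \<phi>_def using smooth_step_bounds[of "?N n * (x - a)"] smooth_step_bounds[of "?N n * (x - b)"] by linarith
      then have "\<bar>g x\<bar> * \<bar>\<phi> n x\<bar> \<le> \<bar>g x\<bar> * smooth_step 1" by (rule mult_left_mono) simp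
      then show "norm (g x * \<phi> n x) \<le> smooth_step 1 * \<bar>indicator {a..b + 1} x *\<^sub>R g x\<bar>"
        using \<phi>0[of x n] by (cases "x \<in> {a..b + 1}") (auto simp: abs_mult mult.commute)
    qed
  qed
  then have "(\<lambda>n. - (LBINT x. g x * \<phi> n x)) \<longlonglongrightarrow> - (LBINT x. g x * (smooth_step 1 * indicator {a<..b} x))"
    by (rule tendsto_minus)
  with lhs have "f a * smooth_step 1 - f b * smooth_step 1 = - (LBINT x. g x * (smooth_step 1 * indicator {a<..b} x))"
    by (rule LIMSEQ_unique)
  also have "(LBINT x. g x * (smooth_step 1 * indicator {a<..b} x)) = smooth_step 1 * (LBINT x:{a<..b}. g x)"
    unfolding set_lebesgue_integral_def integral_mult_right_zero[symmetric] by (simp add: mult_ac)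
  also have "(LBINT x:{a<..b}. g x) = (LBINT x:{a..b}. g x)"
  proof -
    have "AE x in lborel. x \<noteq> a" by (rule AE_lborel_singleton)
    then show ?thesis unfolding set_lebesgue_integral_def
      by (intro integral_cong_AE) (use meas ab in \<open>auto simp: indicator_def elim!: eventually_mono\<close>)
  qed
  finally have "smooth_step 1 * (LBINT x:{a..b}. g x) = smooth_step 1 * (f b - f a)"
    by (simp add: algebra_simps)
  then show ?thesis using smooth_step_1_pos by simp
qed

text \<open>The positive and the negative part give the same mass to every half-line and hence are densities of
  the same measure.\<close>

lemma AE_eq_0_if_interval_integrals_0:
  fixes k :: "real \<Rightarrow> real"
  assumes k: "integrable lborel k" and z: "\<And>x. (LBINT y:{x<..}. k y) = 0"
  shows "AE x in lborel. k x = 0"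
proof -
  let ?p = "\<lambda>x. max 0 (k x)" and ?n = "\<lambda>x. max 0 (- k x)"
  have int: "integrable lborel ?p" "integrable lborel ?n" using k by auto
  have [measurable]: "k \<in> borel_measurable borel" using k by auto
  have em: "emeasure (density lborel (\<lambda>x. ennreal (h x))) {x<..} = ennreal (LBINT y:{x<..}. h y)"
    if "integrable lborel h" "\<And>x. 0 \<le> h x" for h :: "real \<Rightarrow> real" and x
  proof -
    have i: "integrable lborel (\<lambda>y. indicator {x<..} y * h y)"
      unfolding real_scaleR_def[symmetric] by (rule integrable_mult_indicator[OF _ that(1)]) simp
    have "emeasure (density lborel (\<lambda>x. ennreal (h x))) {x<..} = (\<integral>\<^sup>+y. ennreal (indicator {x<..} y * h y) \<partial>lborel)"
      using that by (subst emeasure_density) (auto intro!: nn_integral_cong split: split_indicator)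
    also have "\<dots> = ennreal (LBINT y:{x<..}. h y)"
      unfolding set_lebesgue_integral_def real_scaleR_def using that(2) by (intro nn_integral_eq_integral i) auto
    finally show ?thesis .
  qed
  have "(LBINT y:{x<..}. ?p y) = (LBINT y:{x<..}. ?n y)" for x
  proof -
    have "(LBINT y:{x<..}. ?p y) - (LBINT y:{x<..}. ?n y) = (LBINT y:{x<..}. ?p y - ?n y)"
      using int by (intro set_integral_diff(2)[symmetric]) (auto simp: set_integrable_def intro!: integrable_mult_indicator[where 'b = real, unfolded real_scaleR_def])
    also have "(\<lambda>y. ?p y - ?n y) = k" by auto
    finally show ?thesis using z by simp
  qed
  then have "density lborel (\<lambda>x. ennreal (?p x)) = density lborel (\<lambda>x. ennreal (?n x))"
    by (intro measure_eqI_lessThan) (simp_all add: em int)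
  then have "AE x in lborel. ennreal (?p x) = ennreal (?n x)"
    by (intro sigma_finite_measure.density_unique[OF sigma_finite_lborel]) auto
  then show ?thesis by eventually_elim (auto simp: max_def split: if_splits)
qed

lemma has_weak_deriv_unique_AE:
  assumes f: "continuous_on UNIV f" and g: "has_weak_deriv f g" and h: "has_weak_deriv f h"
  shows "AE x in lborel. g x = h x"
proof -
  have gi: "set_integrable lborel {a..b} g" and hi: "set_integrable lborel {a..b} h" for a b
    using g h by (auto simp: has_weak_deriv_def locally_integrable_def)
  have "AE x in lborel. indicator {- real n..real n} x *\<^sub>R (g x - h x) = 0" for n
  proof (rule AE_eq_0_if_interval_integrals_0)
    have gh: "set_integrable lborel {a..b} (\<lambda>x. g x - h x)" for a b
      using gi hi by (rule set_integral_diff(1))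
    then show "integrable lborel (\<lambda>x. indicator {- real n..real n} x *\<^sub>R (g x - h x))"
      by (simp add: set_integrable_def)
    fix x
    let ?a = "max x (- real n)"
    have "(LBINT y:{x<..}. indicator {- real n..real n} y *\<^sub>R (g y - h y)) = (LBINT y:{?a..real n}. g y - h y)"
      unfolding set_lebesgue_integral_def
    proof (rule integral_cong_AE)
      have "AE y in lborel. y \<noteq> x" by (rule AE_lborel_singleton)
      then show "AE y in lborel. indicator {x<..} y *\<^sub>R indicator {- real n..real n} y *\<^sub>R (g y - h y) = indicator {?a..real n} y *\<^sub>R (g y - h y)"
        by eventually_elim (auto simp: indicator_def)
      have [measurable]: "g \<in> borel_measurable borel" "h \<in> borel_measurable borel"
        using g h by (auto intro: locally_integrable_measurable simp: has_weak_deriv_def)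
      show "(\<lambda>y. indicator {x<..} y *\<^sub>R indicator {- real n..real n} y *\<^sub>R (g y - h y)) \<in> borel_measurable lborel"
        "(\<lambda>y. indicator {?a..real n} y *\<^sub>R (g y - h y)) \<in> borel_measurable lborel" by measurable
    qed
    also have "\<dots> = 0"
    proof (cases "?a \<le> real n")
      case True
      have "(LBINT y:{?a..real n}. g y - h y) = (LBINT y:{?a..real n}. g y) - (LBINT y:{?a..real n}. h y)"
        by (rule set_integral_diff(2)[OF gi hi])
      then show ?thesis
        by (simp only: has_weak_deriv_imp_FTC[OF f g True] has_weak_deriv_imp_FTC[OF f h True] diff_self)
    next
      case False
      then show ?thesis by (simp add: set_lebesgue_integral_def)
    qed
    finally show "(LBINT y:{x<..}. indicator {- real n..real n} y *\<^sub>R (g y - h y)) = 0" .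
  qed
  then have "AE x in lborel. \<forall>n. indicator {- real n..real n} x *\<^sub>R (g x - h x) = 0"
    unfolding AE_all_countable by blast
  then show ?thesis
  proof eventually_elim
    case (elim x)
    obtain n where "\<bar>x\<bar> \<le> real n" using real_arch_simple by blast
    then show ?case using elim[rule_format, of n] by (auto simp: indicator_def)
  qed
qed

text \<open>On \<open>[0, L]\<close> the function vanishes up to distance \<open>1 / n\<close> from the end points and is \<open>1\<close> from distance \<open>2 / n\<close> on.\<close>

definition plateau_cutoff :: "real \<Rightarrow> nat \<Rightarrow> real \<Rightarrow> real" where
  "plateau_cutoff L n s = max 0 (min 1 (real n * min s (L - s) - 1))"

lemma plateau_cutoff_bounds: "0 \<le> plateau_cutoff L n s" "plateau_cutoff L n s \<le> 1"
  by (auto simp: plateau_cutoff_def)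

lemma continuous_on_plateau_cutoff: "continuous_on A (plateau_cutoff L n)"
  unfolding plateau_cutoff_def by (intro continuous_intros)

lemma plateau_cutoff_eq_0:
  assumes "s \<le> 1 / real (Suc n) \<or> L - 1 / real (Suc n) \<le> s"
  shows "plateau_cutoff L (Suc n) s = 0"
proof -
  have "min s (L - s) \<le> 1 / real (Suc n)" using assms by auto
  then have "real (Suc n) * min s (L - s) \<le> real (Suc n) * (1 / real (Suc n))" by (rule mult_left_mono) simp
  then show ?thesis by (simp add: plateau_cutoff_def del: of_nat_Suc)
qed

lemma plateau_cutoff_LIMSEQ: "(\<lambda>n. plateau_cutoff L (Suc n) s) \<longlonglongrightarrow> indicator {0<..<L} s"
proof (cases "s \<in> {0<..<L}")
  case True
  define m where "m = min s (L - s)"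
  have m: "m > 0" using True by (simp add: m_def)
  obtain N where N: "2 / m \<le> real N" using real_arch_simple by blast
  have "\<forall>\<^sub>F n in sequentially. plateau_cutoff L (Suc n) s = 1"
    using eventually_ge_at_top[of N]
  proof eventually_elim
    case (elim n)
    then have "2 / m \<le> real (Suc n)" using N by simp
    then have "2 \<le> real (Suc n) * m" using m by (simp add: pos_divide_le_eq)
    then show ?case by (simp add: plateau_cutoff_def m_def[symmetric] del: of_nat_Suc)
  qed
  then show ?thesis using True by (simp add: tendsto_eventually)
next
  case False
  have "plateau_cutoff L (Suc n) s = 0" for n
  proof (rule plateau_cutoff_eq_0)
    have "0 \<le> 1 / real (Suc n)" by simp
    then show "s \<le> 1 / real (Suc n) \<or> L - 1 / real (Suc n) \<le> s" using False by (simp only: greaterThanLessThan_iff) linarith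
  qed
  then show ?thesis using False by simp
qed

text \<open>A \<open>C\<^sup>1\<close> approximation of the identity on \<open>[0, L]\<close> that is constant near both end points. As for
  \<open>smooth_step\<close>, the integral starts at \<open>-1\<close> to make \<open>0\<close> an interior point.\<close>

definition truncation :: "real \<Rightarrow> nat \<Rightarrow> real \<Rightarrow> real" where
  "truncation L n t = integral {-1..t} (plateau_cutoff L n)"

lemma truncation_has_derivative:
  assumes "-1 < t"
  shows "(truncation L n has_real_derivative plateau_cutoff L n t) (at t)"
proof -
  have "((\<lambda>t. integral {-1..t} (plateau_cutoff L n)) has_real_derivative plateau_cutoff L n t) (at t within {-1..t + 1})"
    using assms by (intro integral_has_real_derivative continuous_on_plateau_cutoff) auto
  moreover have "at t within {-1..t+1} = at t" using assms by (intro at_within_interior) auto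
  ultimately show ?thesis unfolding truncation_def[abs_def] by simp
qed

lemma truncation_LIMSEQ:
  assumes "0 \<le> t" "t \<le> L"
  shows "(\<lambda>n. truncation L (Suc n) t) \<longlonglongrightarrow> t"
proof -
  have "(\<lambda>n. integral {-1..t} (plateau_cutoff L (Suc n))) \<longlonglongrightarrow> integral {-1..t} (indicator {0<..<L})"
    by (rule dominated_convergence(2)[where h = "\<lambda>_. 1"])
      (auto intro: integrable_continuous_interval continuous_on_plateau_cutoff plateau_cutoff_LIMSEQ
        simp: plateau_cutoff_bounds abs_le_iff)
  moreover have "(indicator {0<..<L} has_integral t) {-1..t}"
  proof -
    have "((\<lambda>_. 0) has_integral 0) {-1..0::real}" by simp
    then have "(indicator {0<..<L} has_integral 0) {-1..0::real}"
      by (rule has_integral_cong[THEN iffD1, rotated]) auto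
    moreover have "((\<lambda>_. 1) has_integral t) {0..t}" using has_integral_const_real[of "1::real" 0 t] assms by simp
    then have "(indicator {0<..<L} has_integral t) {0..t}"
      by (rule has_integral_spike_finite[of "{0, L}", rotated 2]) (use assms in \<open>auto simp: indicator_def\<close>)
    ultimately have "(indicator {0<..<L} has_integral (0 + t)) {-1..t}"
      using assms by (intro Henstock_Kurzweil_Integration.has_integral_combine[of "-1" 0 t]) auto
    then show ?thesis by simp
  qed
  ultimately show ?thesis unfolding truncation_def by (simp add: integral_unique)
qed

lemma truncation_bounds:
  assumes "-1 \<le> t"
  shows "\<bar>truncation L n t\<bar> \<le> t + 1"
proof -
  have "\<bar>truncation L n t\<bar> \<le> 1 * (t - - 1)"
    unfolding truncation_def real_norm_def[symmetric]
    using assms by (intro integral_bound continuous_on_plateau_cutoff) (auto simp: plateau_cutoff_bounds abs_le_iff)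
  then show ?thesis by simp
qed

text \<open>The truncation is constant around the extreme values of \<open>f\<close>, so the composition is differentiable also at
  points where \<open>f\<close> attains them without being differentiable.\<close>

lemma truncation_comp_has_derivative:
  assumes f: "continuous_on UNIV f" "\<And>x. 0 \<le> f x" "\<And>x. f x \<le> L"
    and D: "\<And>x. 0 < f x \<Longrightarrow> f x < L \<Longrightarrow> (f has_real_derivative g x) (at x)"
    and g: "\<And>x. 0 < f x \<Longrightarrow> f x < L \<Longrightarrow> isCont g x"
  shows "((\<lambda>x. truncation L (Suc n) (f x)) has_real_derivative plateau_cutoff L (Suc n) (f x) * g x) (at x)"
    and "isCont (\<lambda>x. plateau_cutoff L (Suc n) (f x) * g x) x"
proof -
  have fx: "isCont f x" using f(1) by (simp add: continuous_on_eq_continuous_at)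
  have "((\<lambda>x. truncation L (Suc n) (f x)) has_real_derivative plateau_cutoff L (Suc n) (f x) * g x) (at x) \<and>
    isCont (\<lambda>x. plateau_cutoff L (Suc n) (f x) * g x) x"
  proof (cases "0 < f x \<and> f x < L")
    case True
    then have "-1 < f x" by simp
    have "isCont (plateau_cutoff L (Suc n)) (f x)"
      using continuous_on_plateau_cutoff[of UNIV] by (simp add: continuous_on_eq_continuous_at)
    with fx have "isCont (\<lambda>x. plateau_cutoff L (Suc n) (f x)) x" by (rule isCont_o2)
    then show ?thesis
      using DERIV_chain2[OF truncation_has_derivative[OF \<open>-1 < f x\<close>] D] g[of x] True
      by (auto intro!: continuous_intros)
  next
    case False
    \<comment> \<open>A neighbourhood of the extreme value on which the truncation is constant, within the domain of its derivative rule.\<close>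
    define J where "J = (if f x = 0 then {-1<..<1 / real (Suc n)} else {max (-1) (L - 1 / real (Suc n))<..})"
    have J: "open J" "convex J" "J \<subseteq> {-1<..}" by (auto simp: J_def)
    have "f x = 0 \<or> f x = L" using False f(2,3)[of x] by linarith
    then have fJ: "f x \<in> J" using f(2)[of x] by (auto simp: J_def)
    have cut: "plateau_cutoff L (Suc n) s = 0" if "s \<in> J" for s
      using that by (intro plateau_cutoff_eq_0) (auto simp: J_def split: if_splits)
    obtain c where c: "\<And>s. s \<in> J \<Longrightarrow> truncation L (Suc n) s = c"
    proof -
      have "\<exists>c. \<forall>s\<in>J. truncation L (Suc n) s = c"
      proof (rule has_field_derivative_zero_constant[OF J(2)])
        fix s assume s: "s \<in> J"
        then have "-1 < s" using J(3) by auto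
        from truncation_has_derivative[OF this, of L "Suc n"]
        show "(truncation L (Suc n) has_real_derivative 0) (at s within J)"
          by (simp add: cut[OF s] has_field_derivative_at_within)
      qed
      then show ?thesis using that by blast
    qed
    let ?U = "f -` J"
    have U: "open ?U" "x \<in> ?U" using J(1) f(1) fJ by (auto intro: open_vimage)
    have "((\<lambda>_. c) has_real_derivative 0) (at x)" by simp
    then have 1: "((\<lambda>x. truncation L (Suc n) (f x)) has_real_derivative 0) (at x)"
      by (rule has_field_derivative_transform_within_open[OF _ U]) (simp add: c)
    have "isCont (\<lambda>_. 0 :: real) x" by simp
    moreover have "\<forall>\<^sub>F y in nhds x. (0::real) = plateau_cutoff L (Suc n) (f y) * g y"
      using eventually_nhds_in_open[OF U] by eventually_elim (simp add: cut)
    ultimately have "isCont (\<lambda>x. plateau_cutoff L (Suc n) (f x) * g x) x"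
      using isCont_cong[of "\<lambda>_. 0 :: real" "\<lambda>x. plateau_cutoff L (Suc n) (f x) * g x" x] by simp
    with 1 cut[OF fJ] show ?thesis by simp
  qed
  then show "((\<lambda>x. truncation L (Suc n) (f x)) has_real_derivative plateau_cutoff L (Suc n) (f x) * g x) (at x)"
    "isCont (\<lambda>x. plateau_cutoff L (Suc n) (f x) * g x) x" by auto
qed

lemma test_function_support:
  assumes "test_function \<phi>"
  obtains R where "0 < R" "\<And>x. x \<notin> {-R..R} \<Longrightarrow> \<phi> x = 0" "\<And>x. x \<notin> {-R..R} \<Longrightarrow> deriv \<phi> x = 0"
proof -
  define S where "S = closure {x. \<phi> x \<noteq> 0}"
  have "bounded S" using assms by (simp add: test_function_def compact_imp_bounded S_def)
  moreover have closed_S: "closed S" by (simp add: S_def)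
  ultimately obtain R where R: "0 < R" "\<And>x. x \<in> S \<Longrightarrow> norm x \<le> R" using bounded_pos by metis
  have out: "x \<in> - S" if "x \<notin> {-R..R}" for x using R(2)[of x] that by auto
  have z: "\<phi> x = 0" if "x \<in> - S" for x using that closure_subset[of "{x. \<phi> x \<noteq> 0}"] by (auto simp: S_def)
  have z': "deriv \<phi> x = 0" if "x \<in> - S" for x
  proof (rule DERIV_imp_deriv)
    have "((\<lambda>_. 0) has_real_derivative 0) (at x)" by simp
    then show "(\<phi> has_real_derivative 0) (at x)"
      by (rule has_field_derivative_transform_within_open[where S = "- S"]) (use that z in \<open>simp_all add: open_Compl closed_S\<close>)
  qed
  show ?thesis using R(1) z[OF out] z'[OF out] by (rule that)
qed

text \<open>The set where \<open>f\<close> takes its extreme values may have a complicated boundary with positive measure.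
  Nevertheless the derivative has no part on it: integration by parts holds for the truncations of
  \<open>f\<close>, and both sides converge by dominated convergence. A function like the Cantor function is excluded
  by the requirement that \<open>f\<close> is differentiable as soon as its value is not extreme.\<close>

lemma has_weak_deriv_between_plateaus:
  assumes f: "continuous_on UNIV f" "\<And>x. 0 \<le> f x" "\<And>x. f x \<le> L"
    and D: "\<And>x. 0 < f x \<Longrightarrow> f x < L \<Longrightarrow> (f has_real_derivative g x) (at x)"
    and g: "\<And>x. 0 < f x \<Longrightarrow> f x < L \<Longrightarrow> isCont g x"
    and g0: "\<And>x. \<not> (0 < f x \<and> f x < L) \<Longrightarrow> g x = 0"
    and gi: "locally_integrable g"
  shows "has_weak_deriv f g"
proof -
  have "(LBINT x. f x * deriv \<phi> x) = - (LBINT x. g x * \<phi> x)" if \<phi>: "test_function \<phi>" for \<phi>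
  proof -
    obtain R where R: "0 < R" "\<And>x. x \<notin> {-R..R} \<Longrightarrow> \<phi> x = 0" "\<And>x. x \<notin> {-R..R} \<Longrightarrow> deriv \<phi> x = 0"
      using test_function_support[OF \<phi>] by blast
    have "(deriv ^^ 0) \<phi> differentiable at x" "(deriv ^^ Suc 0) \<phi> differentiable at x" for x
      using \<phi> unfolding test_function_def by blast+
    then have D\<phi>: "(\<phi> has_real_derivative deriv \<phi> x) (at x)" and C\<phi>: "isCont (deriv \<phi>) x" for x
      by (auto simp: DERIV_deriv_iff_real_differentiable intro: differentiable_imp_continuous_within)
    let ?F = "\<lambda>n x. truncation L (Suc n) (f x)" and ?g = "\<lambda>n x. plateau_cutoff L (Suc n) (f x) * g x"
    note DF = truncation_comp_has_derivative[OF f D g]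
    have parts: "(LBINT x. ?F n x * deriv \<phi> x) = - (LBINT x. ?g n x * \<phi> x)" for n
    proof -
      \<comment> \<open>One unit beyond the support of \<open>\<phi>\<close>, so that the boundary terms vanish.\<close>
      have "(LBINT x. (?F n x * deriv \<phi> x) * indicator {-R-1..R+1} x)
        = ?F n (R+1) * \<phi> (R+1) - ?F n (-R-1) * \<phi> (-R-1) - (LBINT x. (?g n x * \<phi> x) * indicator {-R-1..R+1} x)"
        using R(1) by (intro integral_by_parts DF D\<phi> C\<phi>) auto
      moreover have "(\<lambda>x. (?F n x * deriv \<phi> x) * indicator {-R-1..R+1} x) = (\<lambda>x. ?F n x * deriv \<phi> x)"
      proof (rule ext)
        fix x
        show "(?F n x * deriv \<phi> x) * indicator {-R-1..R+1} x = ?F n x * deriv \<phi> x"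
          using R(1) R(3)[of x] by (cases "x \<in> {-R..R}") auto
      qed
      moreover have "(\<lambda>x. (?g n x * \<phi> x) * indicator {-R-1..R+1} x) = (\<lambda>x. ?g n x * \<phi> x)"
      proof (rule ext)
        fix x
        show "(?g n x * \<phi> x) * indicator {-R-1..R+1} x = ?g n x * \<phi> x"
          using R(1) R(2)[of x] by (cases "x \<in> {-R..R}") auto
      qed
      moreover have "\<phi> (R+1) = 0" "\<phi> (-R-1) = 0" using R by auto
      ultimately show ?thesis by simp
    qed
    have cont\<phi>: "continuous_on UNIV \<phi>" "continuous_on UNIV (deriv \<phi>)"
      using D\<phi> C\<phi> by (auto intro: DERIV_isCont continuous_at_imp_continuous_on)
    have contF: "continuous_on UNIV (?F n)" "continuous_on UNIV (?g n)" for n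
      using DF by (auto intro: DERIV_isCont continuous_at_imp_continuous_on)
    have [measurable]: "f \<in> borel_measurable borel" "\<phi> \<in> borel_measurable borel" "deriv \<phi> \<in> borel_measurable borel"
       "g \<in> borel_measurable borel" "?F n \<in> borel_measurable borel" "?g n \<in> borel_measurable borel" for n
      using cont\<phi> contF f(1) locally_integrable_measurable[OF gi] by (auto intro: borel_measurable_continuous_onI)
    have lim1: "(\<lambda>n. LBINT x. ?F n x * deriv \<phi> x) \<longlonglongrightarrow> (LBINT x. f x * deriv \<phi> x)"
    proof (rule integral_dominated_convergence)
      show "integrable lborel (\<lambda>x. (L + 1) * \<bar>deriv \<phi> x\<bar>)"
        by (rule integrable_compact_support[where a = "-R" and b = R]) (use R cont\<phi> in \<open>auto intro!: continuous_intros\<close>)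
      show "AE x in lborel. (\<lambda>n. ?F n x * deriv \<phi> x) \<longlonglongrightarrow> f x * deriv \<phi> x"
        by (intro AE_I2 tendsto_mult truncation_LIMSEQ f tendsto_const)
      show "AE x in lborel. norm (?F n x * deriv \<phi> x) \<le> (L + 1) * \<bar>deriv \<phi> x\<bar>" for n
      proof (rule AE_I2)
        fix x
        have "\<bar>?F n x\<bar> \<le> L + 1"
          using truncation_bounds[of "f x" L "Suc n"] f(2)[of x] f(3)[of x] by linarith
        then show "norm (?F n x * deriv \<phi> x) \<le> (L + 1) * \<bar>deriv \<phi> x\<bar>" by (simp add: abs_mult mult_right_mono)
      qed
    qed measurable
    have "compact (\<phi> ` {-R..R})" by (intro compact_continuous_image continuous_on_subset[OF cont\<phi>(1)]) auto
    then obtain B where B: "\<And>x. x \<in> {-R..R} \<Longrightarrow> \<bar>\<phi> x\<bar> \<le> B"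
      using bounded_iff[of "\<phi> ` {-R..R}"] compact_imp_bounded by fastforce
    have lim2: "(\<lambda>n. LBINT x. ?g n x * \<phi> x) \<longlonglongrightarrow> (LBINT x. g x * \<phi> x)"
    proof (rule integral_dominated_convergence)
      show "integrable lborel (\<lambda>x. B * \<bar>indicator {-R..R} x *\<^sub>R g x\<bar>)"
        using gi unfolding locally_integrable_def set_integrable_def by (intro integrable_mult_right integrable_abs) blast
      show "AE x in lborel. (\<lambda>n. ?g n x * \<phi> x) \<longlonglongrightarrow> g x * \<phi> x"
      proof (rule AE_I2)
        fix x
        have "(\<lambda>n. ?g n x) \<longlonglongrightarrow> indicator {0<..<L} (f x) * g x"
          by (intro tendsto_mult plateau_cutoff_LIMSEQ tendsto_const)
        moreover have "indicator {0<..<L} (f x) * g x = g x" using g0[of x] by (auto simp: indicator_def)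
        ultimately show "(\<lambda>n. ?g n x * \<phi> x) \<longlonglongrightarrow> g x * \<phi> x" by (intro tendsto_mult tendsto_const) simp
      qed
      show "AE x in lborel. norm (?g n x * \<phi> x) \<le> B * \<bar>indicator {-R..R} x *\<^sub>R g x\<bar>" for n
      proof (rule AE_I2)
        fix x
        show "norm (?g n x * \<phi> x) \<le> B * \<bar>indicator {-R..R} x *\<^sub>R g x\<bar>"
        proof (cases "x \<in> {-R..R}")
          case True
          have "\<bar>?g n x\<bar> \<le> 1 * \<bar>g x\<bar>"
            unfolding abs_mult by (intro mult_right_mono) (auto simp: plateau_cutoff_bounds abs_le_iff)
          then have "\<bar>?g n x\<bar> * \<bar>\<phi> x\<bar> \<le> \<bar>g x\<bar> * B" using B[OF True] by (intro mult_mono) auto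
          then show ?thesis using True by (simp add: abs_mult mult.commute)
        qed (use R(2) in simp)
      qed
    qed measurable
    have "(\<lambda>n. - (LBINT x. ?g n x * \<phi> x)) \<longlonglongrightarrow> - (LBINT x. g x * \<phi> x)" using lim2 by (rule tendsto_minus)
    with lim1 show ?thesis unfolding parts by (rule LIMSEQ_unique)
  qed
  then show ?thesis using gi by (simp add: has_weak_deriv_def)
qed

lemma has_weak_deriv_weak_deriv:
  assumes "f \<in> W11_loc"
  shows "has_weak_deriv f (weak_deriv f)"
proof -
  obtain g where "has_weak_deriv f g" using assms by (auto simp: W11_loc_def)
  then show ?thesis unfolding weak_deriv_def by (rule someI[where P = "has_weak_deriv f"])
qed

text \<open>A weak derivative that agrees almost everywhere with a continuous function on an open set is a
  classical derivative there, because increments of \<open>f\<close> are integrals of that continuous function.\<close>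

lemma DERIV_from_weak_deriv:
  assumes f: "continuous_on UNIV f" and wd: "has_weak_deriv f g"
    and U: "open U" "x \<in> U" and h: "\<And>y. y \<in> U \<Longrightarrow> isCont h y"
    and AE: "AE y in lborel. y \<in> U \<longrightarrow> g y = h y"
  shows "(f has_real_derivative h x) (at x)"
proof -
  obtain e where e: "e > 0" "cball x e \<subseteq> U" using U open_contains_cball by blast
  then have sub: "{x - e..x + e} \<subseteq> U" by (simp add: cball_eq_atLeastAtMost)
  have h': "continuous_on {x - e..x + e} h" using sub h by (intro continuous_at_imp_continuous_on) auto
  have eq: "f y = f (x - e) + integral {x - e..y} h" if y: "y \<in> {x - e..x + e}" for y
  proof -
    have hy: "set_integrable lborel {x - e..y} h"
      using y by (intro borel_integrable_atLeastAtMost' continuous_on_subset[OF h']) auto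
    have gm: "g \<in> borel_measurable borel" using wd by (intro locally_integrable_measurable) (simp add: has_weak_deriv_def)
    have "f y - f (x - e) = (LBINT t:{x - e..y}. g t)"
      using has_weak_deriv_imp_FTC[OF f wd, of "x - e" y] y by simp
    also have "\<dots> = (LBINT t:{x - e..y}. h t)"
      unfolding set_lebesgue_integral_def
    proof (rule integral_cong_AE)
      show "(\<lambda>t. indicator {x - e..y} t *\<^sub>R g t) \<in> borel_measurable lborel" using gm by measurable
      show "(\<lambda>t. indicator {x - e..y} t *\<^sub>R h t) \<in> borel_measurable lborel"
        using hy unfolding set_integrable_def by (rule borel_measurable_integrable)
      show "AE t in lborel. indicator {x - e..y} t *\<^sub>R g t = indicator {x - e..y} t *\<^sub>R h t"
        using AE by eventually_elim (use y subsetD[OF sub] in \<open>auto simp: indicator_def\<close>)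
    qed
    also have "\<dots> = integral {x - e..y} h" using hy by (rule set_borel_integral_eq_integral)
    finally show ?thesis by simp
  qed
  have "((\<lambda>y. integral {x - e..y} h) has_real_derivative h x) (at x within {x - e..x + e})"
    using e by (intro integral_has_real_derivative h') auto
  moreover have "at x within {x - e..x + e} = at x" using e by (intro at_within_interior) auto
  ultimately have "((\<lambda>y. f (x - e) + integral {x - e..y} h) has_real_derivative h x) (at x)"
    by (auto intro!: derivative_eq_intros)
  then show ?thesis
  proof (rule has_field_derivative_transform_within_open[where S = "{x - e<..<x + e}"])
    show "f (x - e) + integral {x - e..y} h = f y" if "y \<in> {x - e<..<x + e}" for y
      by (rule eq[symmetric]) (use that in auto)
  qed (use e in auto)
qed

section \<open>The pressure and its conjugate variable\<close>

text \<open>A monotone function can only be discontinuous by a jump, and a jump would leave a gap in its range.\<close>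

lemma continuous_on_strict_antimono_onto:
  fixes f :: "'a::linorder_topology \<Rightarrow> real"
  assumes anti: "\<And>x y. x < y \<Longrightarrow> f y < f x" and range: "range f = {p..q}"
  shows "continuous_on UNIV f"
proof -
  have lt: "x < y" if "f y < f x" for x y
    using that anti[of y x] by (cases x y rule: linorder_cases) auto
  have rng: "p \<le> f x" "f x \<le> q" for x using range by auto
  have "(f \<longlongrightarrow> f x) (at x)" for x
  proof (rule order_tendstoI)
    fix c assume c: "c < f x"
    show "\<forall>\<^sub>F y in at x. c < f y"
    proof (cases "c < p")
      case True
      then show ?thesis using rng(1) by (auto intro: always_eventually less_le_trans)
    next
      case False
      then have "(c + f x) / 2 \<in> range f" using c rng(2)[of x] unfolding range by auto
      then obtain z where z: "f z = (c + f x) / 2" by auto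
      then have "x < z" using c by (intro lt) auto
      then have "\<forall>\<^sub>F y in at x. y < z"
        using order_tendstoD(2)[OF tendsto_ident_at] by blast
      then show ?thesis
        by eventually_elim (use anti[of _ z] z c in fastforce)
    qed
  next
    fix c assume c: "f x < c"
    show "\<forall>\<^sub>F y in at x. f y < c"
    proof (cases "q < c")
      case True
      then show ?thesis using rng(2) by (auto intro: always_eventually le_less_trans)
    next
      case False
      then have "(c + f x) / 2 \<in> range f" using c rng(1)[of x] unfolding range by auto
      then obtain z where z: "f z = (c + f x) / 2" by auto
      then have "z < x" using c by (intro lt) auto
      then have "\<forall>\<^sub>F y in at x. z < y"
        using order_tendstoD(1)[OF tendsto_ident_at] by blast
      then show ?thesis
        by eventually_elim (use anti[of z] z c in fastforce)
    qed
  qed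
  then show ?thesis by (simp add: continuous_on_eq_continuous_at isCont_def)
qed

text \<open>If the increments of \<open>p\<close> are those of \<open>q\<close> times a factor that has a limit, then \<open>p\<close> inherits
  differentiability from \<open>q\<close>. This is used with factors that are quotients of increments, in both
  directions.\<close>

lemma has_derivative_mult_slope:
  fixes p q \<theta> :: "real \<Rightarrow> real"
  assumes q: "(q has_real_derivative D) (at x)"
    and ev: "\<forall>\<^sub>F y in at x. p y - p x = \<theta> y * (q y - q x)"
    and \<theta>: "(\<theta> \<longlongrightarrow> c) (at x)"
  shows "(p has_real_derivative c * D) (at x)"
proof -
  have "((\<lambda>y. \<theta> y * ((q y - q x) / (y - x))) \<longlongrightarrow> c * D) (at x)"
    using q \<theta> by (intro tendsto_mult) (auto simp: has_field_derivative_iff)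
  moreover have "\<forall>\<^sub>F y in at x. \<theta> y * ((q y - q x) / (y - x)) = (p y - p x) / (y - x)"
    using ev by eventually_elim simp
  ultimately show ?thesis
    unfolding has_field_derivative_iff by (rule Lim_transform_eventually)
qed

text \<open>What is needed of \<open>\<beta>\<close> and of the integral \<open>G r\<close> of \<open>\<beta>' s / s\<close> over \<open>s > r\<close>. The two inequalities \<open>slope\<close> say
  that \<open>dG = - d\<beta> / r\<close> in the sense of Stieltjes; they make sense without dividing by \<open>\<beta>'\<close>, which may have
  zeros.\<close>

locale saturating_pressure =
  fixes \<beta> G :: "real \<Rightarrow> real" and L d :: real
  assumes mono: "strict_mono_on {0..} \<beta>"
    and cont: "continuous_on {0..} \<beta>"
    and zero: "\<beta> 0 = 0"
    and lim: "(\<beta> \<longlongrightarrow> L) at_top"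
    and slope: "\<And>r s. 0 < r \<Longrightarrow> r < s \<Longrightarrow> (\<beta> s - \<beta> r) / s \<le> G r - G s"
      "\<And>r s. 0 < r \<Longrightarrow> r < s \<Longrightarrow> G r - G s \<le> (\<beta> s - \<beta> r) / r"
    and G_top: "(G \<longlongrightarrow> 0) at_top"
    and G_0: "(G \<longlongrightarrow> d) (at_right 0)"
    and deriv_energy: "\<And>r. 0 < r \<Longrightarrow> deriv (energy \<beta>) r = - G r"
    and dd: "dd \<beta> = ereal d"
begin

lemma \<beta>_less: "0 \<le> r \<Longrightarrow> r < s \<Longrightarrow> \<beta> r < \<beta> s"
  using mono by (auto simp: strict_mono_on_def)

lemma \<beta>_less_L: assumes "0 \<le> r" shows "\<beta> r < L"
proof -
  have "\<forall>\<^sub>F s in at_top. \<beta> (r + 1) \<le> \<beta> s"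
    using eventually_gt_at_top[of "r + 1"]
    by eventually_elim (use assms \<beta>_less[of "r + 1"] in \<open>auto intro: less_imp_le\<close>)
  then have "\<beta> (r + 1) \<le> L" by (intro tendsto_lowerbound[OF lim]) auto
  then show ?thesis using \<beta>_less[of r "r + 1"] assms by simp
qed

lemma G_less: assumes "0 < r" "r < s" shows "G s < G r"
proof -
  have "0 < (\<beta> s - \<beta> r) / s" using assms \<beta>_less[of r s] by simp
  then show ?thesis using slope(1)[OF assms] by simp
qed

lemma G_pos: assumes "0 < r" shows "0 < G r"
proof -
  have "\<forall>\<^sub>F s in at_top. G s \<le> G (r + 1)"
    using eventually_gt_at_top[of "r + 1"]
    by eventually_elim (use assms G_less[of "r + 1"] in \<open>auto intro: less_imp_le\<close>)
  then have "0 \<le> G (r + 1)" by (intro tendsto_upperbound[OF G_top]) auto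
  then show ?thesis using G_less[of r "r + 1"] assms by simp
qed

lemma G_less_d: assumes "0 < r" shows "G r < d"
proof -
  have "\<forall>\<^sub>F s in at_right 0. G (r / 2) \<le> G s"
    unfolding eventually_at_right_field
    by (intro exI[of _ "r / 2"]) (use assms in \<open>auto intro: less_imp_le[OF G_less]\<close>)
  then have "G (r / 2) \<le> d" by (intro tendsto_lowerbound[OF G_0]) auto
  then show ?thesis using G_less[of "r / 2" r] assms by simp
qed

lemma d_pos: "0 < d"
  using G_pos[of 1] G_less_d[of 1] by simp

lemma isCont_\<beta>: "0 < r \<Longrightarrow> isCont \<beta> r"
  using cont by (intro continuous_on_interior) auto

text \<open>The difference quotient of \<open>G\<close> with respect to \<open>\<beta>\<close>; it extends continuously by \<open>- 1 / s\<close>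
  to the diagonal.\<close>

definition ratio :: "real \<Rightarrow> real \<Rightarrow> real" where
  "ratio s r = (if r = s then - 1 / s else (G r - G s) / (\<beta> r - \<beta> s))"

lemma ratio_eq: assumes "0 < r" "0 < s" shows "G r - G s = ratio s r * (\<beta> r - \<beta> s)"
  using \<beta>_less[of r s] \<beta>_less[of s r] assms by (cases r s rule: linorder_cases) (auto simp: ratio_def)

lemma ratio_bound: assumes "0 < r" "0 < s" shows "\<bar>ratio s r + 1 / s\<bar> \<le> \<bar>1 / r - 1 / s\<bar>"
proof (cases r s rule: linorder_cases)
  case less
  then have "1 / s \<le> (G r - G s) / (\<beta> s - \<beta> r)" "(G r - G s) / (\<beta> s - \<beta> r) \<le> 1 / r"
    using slope[of r s] \<beta>_less[of r s] assms by (simp_all add: field_simps)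
  moreover have "ratio s r = - ((G r - G s) / (\<beta> s - \<beta> r))"
    using less by (simp add: ratio_def minus_divide_right)
  ultimately show ?thesis by simp
next
  case greater
  then have "1 / r \<le> (G s - G r) / (\<beta> r - \<beta> s)" "(G s - G r) / (\<beta> r - \<beta> s) \<le> 1 / s"
    using slope[of s r] \<beta>_less[of s r] assms by (simp_all add: field_simps)
  moreover have "ratio s r = - ((G s - G r) / (\<beta> r - \<beta> s))"
    using greater by (simp add: ratio_def minus_divide_left)
  ultimately show ?thesis by simp
qed (simp add: ratio_def)

lemma ratio_tendsto: assumes "0 < s" shows "(ratio s \<longlongrightarrow> - 1 / s) (at s)"
proof -
  have "((\<lambda>r. ratio s r + 1 / s) \<longlongrightarrow> 0) (at s)"
  proof (rule Lim_null_comparison)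
    have "\<forall>\<^sub>F r in at s. 0 < r"
      using assms order_tendstoD(1)[OF tendsto_ident_at] by blast
    then show "\<forall>\<^sub>F r in at s. norm (ratio s r + 1 / s) \<le> \<bar>1 / r - 1 / s\<bar>"
      by eventually_elim (use assms ratio_bound in simp)
    have "isCont (\<lambda>r. \<bar>1 / r - 1 / s\<bar>) s" using assms by (intro continuous_intros) auto
    then show "((\<lambda>r. \<bar>1 / r - 1 / s\<bar>) \<longlongrightarrow> 0) (at s)" by (simp add: isCont_def)
  qed
  then show ?thesis using tendsto_add[OF _ tendsto_const[of "- 1 / s"]] by fastforce
qed

lemma isCont_G: assumes "0 < s" shows "isCont G s"
proof -
  have "((\<lambda>r. G s + ratio s r * (\<beta> r - \<beta> s)) \<longlongrightarrow> G s + (- 1 / s) * (\<beta> s - \<beta> s)) (at s)"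
    using isCont_\<beta>[OF assms] by (intro tendsto_intros ratio_tendsto assms) (simp add: isCont_def)
  moreover have "\<forall>\<^sub>F r in at s. 0 < r"
    using assms order_tendstoD(1)[OF tendsto_ident_at] by blast
  then have "\<forall>\<^sub>F r in at s. G s + ratio s r * (\<beta> r - \<beta> s) = G r"
    by eventually_elim (use ratio_eq[OF _ assms] in \<open>simp add: algebra_simps\<close>)
  ultimately have "(G \<longlongrightarrow> G s + (- 1 / s) * (\<beta> s - \<beta> s)) (at s)"
    by (rule Lim_transform_eventually)
  then show ?thesis by (simp add: isCont_def)
qed

lemma G_surj: assumes "0 < v" "v < d" shows "\<exists>r>0. G r = v"
proof -
  have "\<forall>\<^sub>F r in at_right 0. v < G r \<and> 0 < r"
    using order_tendstoD(1)[OF G_0 assms(2)] eventually_at_right_less by (rule eventually_conj)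
  then obtain r where r: "v < G r" "0 < r" using eventually_happens trivial_limit_at_right_real by blast
  have "\<forall>\<^sub>F s in at_top. G s < v \<and> r < s"
    using order_tendstoD(2)[OF G_top assms(1)] eventually_gt_at_top by (rule eventually_conj)
  then obtain s where s: "G s < v" "r < s" using eventually_happens trivial_limit_at_top_linorder by blast
  have "\<exists>x\<ge>r. x \<le> s \<and> G x = v"
    using r s by (intro IVT2) (auto intro!: isCont_G)
  then obtain x where "r \<le> x" "G x = v" by blast
  then show ?thesis using r by (intro exI[of _ x]) auto
qed

lemma \<beta>_surj: assumes "0 \<le> v" "v < L" shows "\<exists>r\<ge>0. \<beta> r = v"
proof -
  have "\<forall>\<^sub>F s in at_top. v < \<beta> s \<and> 0 < s"
    using order_tendstoD(1)[OF lim assms(2)] eventually_gt_at_top by (rule eventually_conj)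
  then obtain s where s: "v < \<beta> s" "0 < s" using eventually_happens trivial_limit_at_top_linorder by blast
  have "\<exists>x\<ge>0. x \<le> s \<and> \<beta> x = v"
    using s assms zero by (intro IVT' continuous_on_subset[OF cont]) auto
  then show ?thesis by blast
qed

text \<open>The continuous extension of \<open>G\<close> to \<open>[0, \<infinity>]\<close>, which is the inverse of \<open>H\<close>.\<close>

definition Gx :: "ennreal \<Rightarrow> real" where
  "Gx r = (if r = \<infinity> then 0 else if r = 0 then d else G (enn2real r))"

lemma Gx_ennreal: "0 < r \<Longrightarrow> Gx (ennreal r) = G r"
  by (simp add: Gx_def)

lemma Gx_less: assumes "x < y" shows "Gx y < Gx x"
proof (cases x)
  case (real a)
  show ?thesis
  proof (cases y)
    case (real b)
    then have "a < b" using assms \<open>x = ennreal a\<close> \<open>0 \<le> a\<close> by (simp add: ennreal_less_iff)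
    then show ?thesis using real \<open>x = ennreal a\<close> \<open>0 \<le> a\<close> G_less[of a b] G_less_d[of b]
      by (cases "a = 0") (auto simp: Gx_def)
  next
    case top
    then show ?thesis using real d_pos G_pos[of a] by (cases "a = 0") (auto simp: Gx_def)
  qed
qed (use assms in simp)

lemma Gx_bounds: "0 \<le> Gx r" "Gx r \<le> d"
proof -
  have "r = \<infinity> \<or> Gx \<infinity> < Gx r" "r = 0 \<or> Gx r < Gx 0"
    using Gx_less[of r \<infinity>] Gx_less[of 0 r] by (auto simp: less_top[symmetric] zero_less_iff_neq_zero)
  then show "0 \<le> Gx r" "Gx r \<le> d" using d_pos by (auto simp: Gx_def)
qed

lemma range_Gx: "range Gx = {0..d}"
proof
  show "range Gx \<subseteq> {0..d}" by (simp add: image_subset_iff Gx_bounds)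
  show "{0..d} \<subseteq> range Gx"
  proof
    fix v assume v: "v \<in> {0..d}"
    consider "v = 0" | "v = d" | "0 < v" "v < d" using v by fastforce
    then show "v \<in> range Gx"
    proof cases
      case 1
      then show ?thesis by (intro range_eqI[of _ _ \<infinity>]) (simp add: Gx_def)
    next
      case 2
      then show ?thesis by (intro range_eqI[of _ _ 0]) (simp add: Gx_def)
    next
      case 3
      then obtain r where "r > 0" "G r = v" using G_surj by blast
      then show ?thesis by (intro range_eqI[of _ _ "ennreal r"]) (simp add: Gx_ennreal)
    qed
  qed
qed

lemma continuous_on_Gx: "continuous_on UNIV Gx"
  by (rule continuous_on_strict_antimono_onto[where f = Gx and p = 0 and q = d, OF _ range_Gx]) (rule Gx_less)

lemma Gx_inj: "Gx x = Gx y \<Longrightarrow> x = y"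
  by (metis Gx_less less_irrefl linorder_neqE)

lemma Gx_eq_d: "Gx r = d \<longleftrightarrow> r = 0"
proof
  show "Gx r = d \<Longrightarrow> r = 0" by (rule Gx_inj) (simp add: Gx_def)
qed (simp add: Gx_def)

lemma beta_ext_top: "beta_ext \<beta> \<infinity> = L"
  unfolding beta_ext_def using tendsto_Lim[OF _ lim] by simp

lemma beta_ext_less: assumes "x < y" shows "beta_ext \<beta> x < beta_ext \<beta> y"
proof (cases x)
  case (real a)
  show ?thesis
  proof (cases y)
    case (real b)
    then show ?thesis using assms \<open>x = ennreal a\<close> \<open>0 \<le> a\<close> \<beta>_less[of a b]
      by (simp add: ennreal_less_iff beta_ext_def)
  next
    case top
    then show ?thesis using real \<beta>_less_L[of a] beta_ext_top by (simp add: beta_ext_def)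
  qed
qed (use assms in simp)

lemma beta_ext_0: "beta_ext \<beta> 0 = 0"
  by (simp add: beta_ext_def zero)

lemma beta_ext_bounds: "0 \<le> beta_ext \<beta> r" "beta_ext \<beta> r \<le> L"
proof -
  have "r = \<infinity> \<or> beta_ext \<beta> r < beta_ext \<beta> \<infinity>" "r = 0 \<or> beta_ext \<beta> 0 < beta_ext \<beta> r"
    using beta_ext_less[of r \<infinity>] beta_ext_less[of 0 r] by (auto simp: less_top[symmetric] zero_less_iff_neq_zero)
  then show "0 \<le> beta_ext \<beta> r" "beta_ext \<beta> r \<le> L"
    using beta_ext_less[of 0 \<infinity>] unfolding beta_ext_top beta_ext_0 by (auto simp: beta_ext_top[simplified] beta_ext_0)
qed

lemma range_beta_ext: "range (beta_ext \<beta>) = {0..L}"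
proof
  show "range (beta_ext \<beta>) \<subseteq> {0..L}" by (simp add: image_subset_iff beta_ext_bounds)
  show "{0..L} \<subseteq> range (beta_ext \<beta>)"
  proof
    fix v assume v: "v \<in> {0..L}"
    show "v \<in> range (beta_ext \<beta>)"
    proof (cases "v = L")
      case True
      then show ?thesis by (intro range_eqI[of _ _ \<infinity>]) (simp only: beta_ext_top)
    next
      case False
      then obtain r where "r \<ge> 0" "\<beta> r = v" using \<beta>_surj[of v] v by auto
      then show ?thesis by (intro range_eqI[of _ _ "ennreal r"]) (simp add: beta_ext_def)
    qed
  qed
qed

lemma continuous_on_beta_ext: "continuous_on UNIV (beta_ext \<beta>)"
proof -
  have "range (\<lambda>r. - beta_ext \<beta> r) = uminus ` range (beta_ext \<beta>)" by auto
  then have "range (\<lambda>r. - beta_ext \<beta> r) = {- L..- 0}" by (simp add: range_beta_ext)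
  then have "continuous_on UNIV (\<lambda>r. - beta_ext \<beta> r)"
    by (rule continuous_on_strict_antimono_onto[where f = "\<lambda>r. - beta_ext \<beta> r", rotated]) (simp add: beta_ext_less)
  then show ?thesis using continuous_on_minus by force
qed

lemma beta_ext_inj: "beta_ext \<beta> x = beta_ext \<beta> y \<Longrightarrow> x = y"
  by (metis beta_ext_less less_irrefl linorder_neqE)

lemma beta_ext_eq_0: "beta_ext \<beta> r = 0 \<longleftrightarrow> r = 0"
  using beta_ext_inj[of r 0] beta_ext_0 by metis

lemma beta_ext_eq_L: "beta_ext \<beta> r = L \<longleftrightarrow> r = \<infinity>"
  using beta_ext_inj[of r \<infinity>] beta_ext_top by metis

lemma H_Gx: "H \<beta> (Gx r) = r"
proof -
  consider "r = \<infinity>" | "r = 0" | "r \<noteq> \<infinity>" "r \<noteq> 0" by blast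
  then show ?thesis
  proof cases
    case 1
    then show ?thesis by (simp add: Gx_def H_def)
  next
    case 2
    then show ?thesis using d_pos by (simp add: Gx_def H_def dd)
  next
    case 3
    define s where "s = enn2real r"
    have s: "s > 0" "r = ennreal s" using 3
      by (auto simp: s_def enn2real_positive_iff less_top[symmetric] zero_less_iff_neq_zero ennreal_enn2real_if)
    have "inj_on (deriv (energy \<beta>)) {0<..}"
    proof (rule inj_onI)
      fix a b :: real assume ab: "a \<in> {0<..}" "b \<in> {0<..}" "deriv (energy \<beta>) a = deriv (energy \<beta>) b"
      then have "G a = G b" by (simp add: deriv_energy)
      then show "a = b" using G_less[of a b] G_less[of b a] ab by (cases a b rule: linorder_cases) auto
    qed
    then have "inv_into {0<..} (deriv (energy \<beta>)) (deriv (energy \<beta>) s) = s" using s by simp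
    then have "inv_into {0<..} (deriv (energy \<beta>)) (- G s) = s" using s by (simp add: deriv_energy)
    then show ?thesis using s G_pos[of s] G_less_d[of s] by (simp add: H_def dd Gx_ennreal)
  qed
qed

lemma Gx_H: assumes "0 \<le> v" "v \<le> d" shows "Gx (H \<beta> v) = v"
proof -
  have "v \<in> range Gx" using assms range_Gx by auto
  then show ?thesis using H_Gx by auto
qed

lemma open_D_plus: assumes "continuous_on UNIV u" shows "open (D_plus u)"
proof -
  have "D_plus u = u -` {0<..<\<infinity>}" by (auto simp: D_plus_def)
  then show ?thesis using continuous_open_vimage assms
    by (metis continuous_on_eq_continuous_within open_greaterThanLessThan UNIV_I continuous_on_open_vimage inf_top.right_neutral open_UNIV)
qed

lemma D_plus_enn2real: "x \<in> D_plus u \<Longrightarrow> 0 < enn2real (u x)" "x \<in> D_plus u \<Longrightarrow> ennreal (enn2real (u x)) = u x"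
  by (auto simp: D_plus_def enn2real_positive_iff)

lemma isCont_enn2real_D_plus:
  assumes u: "continuous_on UNIV u" and x: "x \<in> D_plus u"
  shows "isCont (\<lambda>y. enn2real (u y)) x"
proof -
  have "(u \<longlongrightarrow> ennreal (enn2real (u x))) (at x)"
    using u x D_plus_enn2real by (simp add: continuous_on_eq_continuous_at isCont_def)
  then show ?thesis unfolding isCont_def by (rule tendsto_enn2real) simp
qed

text \<open>Formally both sides differ by the factor \<open>G' / \<beta>' = - 1 / u\<close> of the chain rule. Since \<open>u\<close> need not be
  differentiable at zeros of \<open>\<beta>'\<close>, increments of \<open>G u\<close> are compared with increments of \<open>\<beta> u\<close> directly; their
  quotient \<open>ratio\<close> tends to \<open>- 1 / u\<close>, a nonzero limit, so that the comparison can be reversed.\<close>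

lemma DERIV_Gx_iff_DERIV_beta_ext:
  assumes u: "continuous_on UNIV u" and x: "x \<in> D_plus u"
  shows "((\<lambda>y. Gx (u y)) has_real_derivative - D / enn2real (u x)) (at x) \<longleftrightarrow>
    ((beta_ext \<beta> \<circ> u) has_real_derivative D) (at x)"
proof -
  define w where "w y = enn2real (u y)" for y
  have wx: "w x > 0" using D_plus_enn2real x by (simp add: w_def)
  have w: "(w \<longlongrightarrow> w x) (at x)"
    using isCont_enn2real_D_plus[OF u x] by (simp add: isCont_def w_def[abs_def])
  have D: "\<forall>\<^sub>F y in at x. y \<in> D_plus u"
    using open_D_plus[OF u] x eventually_at_in_open' by blast
  have eq: "Gx (u y) = G (w y)" "(beta_ext \<beta> \<circ> u) y = \<beta> (w y)" "0 < w y" if "y \<in> D_plus u" for y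
    using that D_plus_enn2real(1)[OF that] by (auto simp: D_plus_def w_def Gx_def beta_ext_def)
  have "isCont (ratio (w x)) (w x)" using ratio_tendsto[OF wx] by (simp add: isCont_def ratio_def)
  then have \<theta>: "((\<lambda>y. ratio (w x) (w y)) \<longlongrightarrow> - 1 / w x) (at x)"
    using isCont_tendsto_compose[OF _ w] by (fastforce simp: ratio_def)
  have e1: "\<forall>\<^sub>F y in at x. Gx (u y) - Gx (u x) = ratio (w x) (w y) * ((beta_ext \<beta> \<circ> u) y - (beta_ext \<beta> \<circ> u) x)"
    using D by eventually_elim (use eq x ratio_eq in simp)
  have "\<forall>\<^sub>F y in at x. ratio (w x) (w y) < 0"
    using order_tendstoD(2)[OF \<theta>] wx by simp
  with e1 have e2: "\<forall>\<^sub>F y in at x. (beta_ext \<beta> \<circ> u) y - (beta_ext \<beta> \<circ> u) x = inverse (ratio (w x) (w y)) * (Gx (u y) - Gx (u x))"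
    by eventually_elim (simp add: field_simps)
  show ?thesis
  proof
    assume "((\<lambda>y. Gx (u y)) has_real_derivative - D / enn2real (u x)) (at x)"
    from has_derivative_mult_slope[OF this e2 tendsto_inverse[OF \<theta>]] wx
    show "((beta_ext \<beta> \<circ> u) has_real_derivative D) (at x)" by (simp add: w_def o_def)
  next
    assume "((beta_ext \<beta> \<circ> u) has_real_derivative D) (at x)"
    from has_derivative_mult_slope[OF this e1 \<theta>] wx
    show "((\<lambda>y. Gx (u y)) has_real_derivative - D / enn2real (u x)) (at x)" by (simp add: w_def)
  qed
qed

end

text \<open>On \<open>s > r\<close> the integrand is at most \<open>b s / r\<close>, which is integrable because \<open>\<beta>\<close> has a limit.\<close>

lemma weighted_density_integrals:
  fixes \<beta> b :: "real \<Rightarrow> real"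
  assumes D: "\<And>s. 0 < s \<Longrightarrow> (\<beta> has_real_derivative b s) (at s)"
    and b: "continuous_on {0<..} b" and nonneg: "\<And>s. 0 < s \<Longrightarrow> 0 \<le> b s"
    and lim: "(\<beta> \<longlongrightarrow> L) at_top" and r: "0 < r"
  shows "set_integrable lborel {r<..} (\<lambda>s. b s / s)"
    and "(LBINT s:{r<..}. b s / s) \<le> (L - \<beta> r) / r"
    and "0 \<le> (LBINT s:{r<..}. b s / s)"
proof -
  let ?f = "\<lambda>s. indicator {r..} s *\<^sub>R b s"
  have "continuous_on {r..} b" using r by (intro continuous_on_subset[OF b]) auto
  then have meas: "?f \<in> borel_measurable borel" by (intro borel_measurable_continuous_on_indicator) auto
  have "(\<integral>\<^sup>+x. ennreal (?f x) * indicator {r..} x \<partial>lborel) = L - \<beta> r"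
    using meas r D nonneg lim by (intro nn_integral_FTC_atLeast) auto
  moreover have "(\<integral>\<^sup>+x. ennreal (?f x) * indicator {r..} x \<partial>lborel) = (\<integral>\<^sup>+x. ennreal (?f x) \<partial>lborel)"
    by (intro nn_integral_cong) (auto simp: indicator_def)
  ultimately have nn: "(\<integral>\<^sup>+x. ennreal (?f x) \<partial>lborel) = ennreal (L - \<beta> r)" by simp
  have "\<beta> r \<le> L"
  proof (rule tendsto_lowerbound[OF lim])
    have "\<beta> r \<le> \<beta> s" if "r < s" for s
      using that r by (intro DERIV_nonneg_imp_nondecreasing[of r s \<beta>]) (auto intro!: exI D nonneg)
    then show "\<forall>\<^sub>F s in at_top. \<beta> r \<le> \<beta> s" by (meson eventually_gt_at_top eventually_mono)
  qed auto
  then have hb: "has_bochner_integral lborel ?f (L - \<beta> r)"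
    using meas nn r nonneg by (intro has_bochner_integral_nn_integral) (auto simp: indicator_def)
  have le: "\<bar>indicator {r<..} s *\<^sub>R (b s / s)\<bar> \<le> ?f s / r" "0 \<le> indicator {r<..} s *\<^sub>R (b s / s)" for s
    using r nonneg[of s] by (auto simp: indicator_def abs_mult intro!: divide_left_mono)
  have int: "integrable lborel (\<lambda>s. ?f s / r)"
    using hb by (intro integrable_divide_zero) (auto simp: has_bochner_integral_iff)
  have meas2: "(\<lambda>s. indicator {r<..} s *\<^sub>R (b s / s)) \<in> borel_measurable borel"
    using r by (intro borel_measurable_continuous_on_indicator continuous_on_divide continuous_on_subset[OF b]) auto
  show I: "set_integrable lborel {r<..} (\<lambda>s. b s / s)"
    unfolding set_integrable_def
  proof (rule Bochner_Integration.integrable_bound[OF int])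
    show "AE s in lborel. norm (indicator {r<..} s *\<^sub>R (b s / s)) \<le> norm (?f s / r)"
      unfolding real_norm_def by (intro AE_I2 order_trans[OF le(1) abs_ge_self])
  qed (use meas2 in simp)
  have "(LBINT s:{r<..}. b s / s) \<le> (LBINT s. ?f s / r)"
    unfolding set_lebesgue_integral_def
    using I int order_trans[OF abs_ge_self le(1)] unfolding set_integrable_def by (rule integral_mono)
  also have "\<dots> = (L - \<beta> r) / r" using hb by (simp add: has_bochner_integral_iff)
  finally show "(LBINT s:{r<..}. b s / s) \<le> (L - \<beta> r) / r" .
  show "0 \<le> (LBINT s:{r<..}. b s / s)"
    unfolding set_lebesgue_integral_def using le(2) by (intro integral_nonneg_AE) auto
qed

text \<open>The inequalities \<open>slope\<close> come from \<open>1 / s \<le> 1 / x \<le> 1 / r\<close> in the integral of \<open>b x / x\<close> over \<open>[r, s]\<close>.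
  They give the derivative of the energy and the monotonicity of \<open>G\<close>, and monotonicity turns the limit defining
  \<open>dd \<beta>\<close> into a supremum, which exists in the extended reals and is finite by assumption.\<close>

lemma saturating_pressureI:
  fixes \<beta> :: "real \<Rightarrow> real"
  assumes C1: "continuous_on {0..} b" "\<And>r. 0 \<le> r \<Longrightarrow> (\<beta> has_real_derivative b r) (at r within {0..})"
    and mono: "strict_mono_on {0..} \<beta>" and zero: "\<beta> 0 = 0" and lim: "(\<beta> \<longlongrightarrow> L) at_top"
    and fin: "dd \<beta> < \<infinity>"
  shows "\<exists>G d. saturating_pressure \<beta> G L d"
proof -
  define G where "G r = (LBINT s:{r<..}. b s / s)" for r
  have D: "(\<beta> has_real_derivative b s) (at s)" if "0 < s" for s
  proof -
    have "at s within {0..} = at s" using that by (intro at_within_interior) auto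
    then show ?thesis using C1(2)[of s] that by simp
  qed
  have nonneg: "0 \<le> b s" if "0 < s" for s
    using mono_on_imp_deriv_nonneg[of "{0..}" \<beta> "b s" s] D[OF that] strict_mono_on_imp_mono_on[OF mono] that
    by auto
  have b: "continuous_on {0<..} b" by (rule continuous_on_subset[OF C1(1)]) auto
  note wdi = weighted_density_integrals[OF D b nonneg lim]
  have cont: "continuous_on {0..} \<beta>"
    using C1(2) by (auto intro: DERIV_continuous_on)
  have less: "\<beta> r < \<beta> s" if "0 \<le> r" "r < s" for r s
    using mono that by (auto simp: strict_mono_on_def)
  have G_diff: "((\<lambda>x. b x / x) has_integral (G r - G s)) {r..s}" if "0 < r" "r < s" for r s
  proof -
    have r: "((\<lambda>x. b x / x) has_integral G r) {r..}"
    proof -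
      have "((\<lambda>x. b x / x) has_integral G r) {r<..}"
        using set_borel_integral_eq_integral[OF wdi(1)[OF _ _ \<open>0 < r\<close>]] by (simp add: G_def integrable_integral)
      then show ?thesis
        by (rule has_integral_spike_set_eq[THEN iffD1, rotated -1])
          (auto intro: negligible_subset[of "{r}"])
    qed
    have s: "((\<lambda>x. b x / x) has_integral G s) {s<..}"
      using set_borel_integral_eq_integral[OF wdi(1)] that by (simp add: G_def integrable_integral)
    have "continuous_on {r..s} (\<lambda>x. b x / x)"
      using that by (intro continuous_intros continuous_on_subset[OF b]) auto
    then obtain i where i: "((\<lambda>x. b x / x) has_integral i) {r..s}"
      using integrable_continuous_interval by (meson integrable_on_def)
    have "((\<lambda>x. b x / x) has_integral (i + G s)) ({r..s} \<union> {s<..})"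
      by (rule has_integral_Un[OF i s]) (auto intro: negligible_subset[of "{s}"])
    moreover have "{r..s} \<union> {s<..} = {r..}" using that by auto
    ultimately have "i + G s = G r" using r has_integral_unique by metis
    then have "i = G r - G s" by simp
    then show ?thesis using i by simp
  qed
  have \<beta>_diff: "((\<lambda>x. b x / c) has_integral (\<beta> s - \<beta> r) / c) {r..s}" if "0 < r" "r < s" for r s c
  proof -
    have "(b has_integral (\<beta> s - \<beta> r)) {r..s}"
      using that D by (intro fundamental_theorem_of_calculus)
        (auto simp: has_real_derivative_iff_has_vector_derivative[symmetric] intro: has_field_derivative_at_within)
    then show ?thesis by (rule has_integral_divide)
  qed
  have slope: "(\<beta> s - \<beta> r) / s \<le> G r - G s" "G r - G s \<le> (\<beta> s - \<beta> r) / r" if "0 < r" "r < s" for r s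
    using that nonneg
    by (auto intro!: has_integral_le[OF \<beta>_diff[OF that] G_diff[OF that]] has_integral_le[OF G_diff[OF that] \<beta>_diff[OF that]]
        divide_left_mono)
  have G_less: "G s < G r" if "0 < r" "r < s" for r s
  proof -
    have "0 < (\<beta> s - \<beta> r) / s" using less[of r s] that by simp
    then show ?thesis using slope(1)[OF that] by simp
  qed
  have G_top: "(G \<longlongrightarrow> 0) at_top"
  proof (rule tendsto_sandwich[OF _ _ tendsto_const])
    show "\<forall>\<^sub>F r in at_top. 0 \<le> G r"
      using eventually_gt_at_top[of 0] by eventually_elim (use wdi(3) in \<open>auto simp: G_def\<close>)
    show "\<forall>\<^sub>F r in at_top. G r \<le> (L - \<beta> r) / r"
      using eventually_gt_at_top[of 0] by eventually_elim (use wdi(2) in \<open>auto simp: G_def\<close>)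
    show "((\<lambda>r. (L - \<beta> r) / r) \<longlongrightarrow> 0) at_top"
      by (intro real_tendsto_divide_at_top[where c = "L - L"] tendsto_diff lim tendsto_const filterlim_ident)
  qed
  have energy: "energy \<beta> r = - \<beta> r - r * G r" if "0 < r" for r
  proof -
    have "(LBINT s:{r<..}. deriv \<beta> s / s) = G r"
      unfolding G_def using that D by (intro set_lebesgue_integral_cong) (auto simp: DERIV_imp_deriv)
    then show ?thesis by (simp add: energy_def)
  qed
  have deriv_energy: "deriv (energy \<beta>) r = - G r" if r: "0 < r" for r
  proof (rule DERIV_imp_deriv)
    have ev: "\<forall>\<^sub>F s in at r. 0 < s" using order_tendstoD(1)[OF tendsto_ident_at r] .
    have "((\<lambda>s. (energy \<beta> s - energy \<beta> r) / (s - r) + G r) \<longlongrightarrow> 0) (at r)"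
    proof (rule Lim_null_comparison)
      show "\<forall>\<^sub>F s in at r. norm ((energy \<beta> s - energy \<beta> r) / (s - r) + G r) \<le> \<bar>\<beta> s - \<beta> r\<bar> / r"
        using ev eventually_neq_at_within[of r r UNIV]
      proof eventually_elim
        case (elim s)
        have "(energy \<beta> s - energy \<beta> r) / (s - r) + G r = (s * (G r - G s) - (\<beta> s - \<beta> r)) / (s - r)"
          using elim r by (simp add: energy field_simps)
        \<comment> \<open>By \<open>slope\<close>, the number \<open>s * (G r - G s)\<close> lies between \<open>\<beta> s - \<beta> r\<close> and \<open>s / r\<close> times it, so the numerator is at most \<open>\<bar>s - r\<bar> / r\<close> times the increment of \<open>\<beta>\<close>.\<close>
        also have "\<bar>\<dots>\<bar> \<le> \<bar>\<beta> s - \<beta> r\<bar> / r"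
        proof (cases "r < s")
          case True
          have "s * ((\<beta> s - \<beta> r) / s) \<le> s * (G r - G s)" "s * (G r - G s) \<le> s * ((\<beta> s - \<beta> r) / r)"
            using elim by (intro mult_left_mono slope r True; simp)+
          moreover have "s * ((\<beta> s - \<beta> r) / r) - (\<beta> s - \<beta> r) = (s - r) * ((\<beta> s - \<beta> r) / r)"
            using r by (simp add: field_simps)
          ultimately have "0 \<le> s * (G r - G s) - (\<beta> s - \<beta> r)"
              "s * (G r - G s) - (\<beta> s - \<beta> r) \<le> (s - r) * ((\<beta> s - \<beta> r) / r)"
            using elim by auto
          then have "\<bar>s * (G r - G s) - (\<beta> s - \<beta> r)\<bar> / (s - r) \<le> (\<beta> s - \<beta> r) / r"
            using True by (simp add: pos_divide_le_eq mult.commute)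
          then show ?thesis using True less[of r s] r by (simp add: abs_divide)
        next
          case False
          then have sr: "s < r" using elim by simp
          have "s * ((\<beta> r - \<beta> s) / r) \<le> s * (G s - G r)" "s * (G s - G r) \<le> s * ((\<beta> r - \<beta> s) / s)"
            using elim by (intro mult_left_mono slope sr; simp)+
          moreover have "(\<beta> r - \<beta> s) - s * ((\<beta> r - \<beta> s) / r) = (r - s) * ((\<beta> r - \<beta> s) / r)"
            using r by (simp add: field_simps)
          moreover have "s * ((\<beta> r - \<beta> s) / s) = \<beta> r - \<beta> s" using elim by simp
          moreover have "s * (G r - G s) - (\<beta> s - \<beta> r) = (\<beta> r - \<beta> s) - s * (G s - G r)"
            by (simp add: algebra_simps)
          ultimately have "0 \<le> s * (G r - G s) - (\<beta> s - \<beta> r)"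
              "s * (G r - G s) - (\<beta> s - \<beta> r) \<le> (r - s) * ((\<beta> r - \<beta> s) / r)"
            by linarith+
          then have "\<bar>s * (G r - G s) - (\<beta> s - \<beta> r)\<bar> / (r - s) \<le> (\<beta> r - \<beta> s) / r"
            using sr by (simp add: pos_divide_le_eq mult.commute)
          then show ?thesis using sr less[of s r] r elim by (simp add: abs_divide abs_minus_commute)
        qed
        finally show ?case by simp
      qed
      have "isCont \<beta> r" using D[OF r] by (rule DERIV_isCont)
      then have "isCont (\<lambda>s. \<bar>\<beta> s - \<beta> r\<bar> / r) r" using r by (intro continuous_intros) auto
      then show "((\<lambda>s. \<bar>\<beta> s - \<beta> r\<bar> / r) \<longlongrightarrow> 0) (at r)" by (simp add: isCont_def)
    qed
    from tendsto_add[OF this tendsto_const[of "- G r"]]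
    show "(energy \<beta> has_real_derivative - G r) (at r)" by (simp add: has_field_derivative_iff)
  qed
  define S where "S = (SUP r\<in>{0<..}. ereal (G r))"
  have "((\<lambda>r. ereal (G r)) \<longlongrightarrow> S) (at_right 0)"
  proof (rule order_tendstoI)
    fix a assume "a < S"
    then obtain r where r: "r > 0" "a < ereal (G r)" by (auto simp: S_def less_SUP_iff)
    have "\<forall>\<^sub>F s in at_right 0. s \<in> {0<..<r}" using r by (intro eventually_at_right_real)
    then show "\<forall>\<^sub>F s in at_right 0. a < ereal (G s)"
      by eventually_elim (use G_less r in \<open>force intro: less_trans\<close>)
  next
    fix a assume a: "S < a"
    show "\<forall>\<^sub>F s in at_right 0. ereal (G s) < a"
      using eventually_at_right_less[of 0]
    proof eventually_elim
      case (elim s)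
      then have "ereal (G s) \<le> S" by (auto simp: S_def intro: SUP_upper)
      then show ?case using a by simp
    qed
  qed
  then have lim0: "((\<lambda>r. ereal (G r)) \<longlongrightarrow> S) (at_right 0)" .
  then have "((\<lambda>r. - ereal (G r)) \<longlongrightarrow> - S) (at_right 0)" by (rule tendsto_uminus_ereal)
  moreover have "\<forall>\<^sub>F r in at_right 0. - ereal (G r) = ereal (deriv (energy \<beta>) r)"
    using eventually_at_right_less[of 0] by eventually_elim (simp add: deriv_energy)
  ultimately have "((\<lambda>r. ereal (deriv (energy \<beta>) r)) \<longlongrightarrow> - S) (at_right 0)"
    by (rule Lim_transform_eventually)
  then have dd: "dd \<beta> = S" by (simp add: dd_def tendsto_Lim)
  have "ereal (G 1) \<le> S" by (auto simp: S_def intro: SUP_upper)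
  then obtain d where d: "S = ereal d" using fin dd by (cases S) auto
  then have "(G \<longlongrightarrow> d) (at_right 0)" using lim0 by simp
  then have "saturating_pressure \<beta> G L d"
    using mono cont zero lim slope G_top deriv_energy dd d by unfold_locales auto
  then show ?thesis by blast
qed

section \<open>Sets of real numbers and measures\<close>

text \<open>Countable additivity in terms of unordered sums: the sum is the supremum over finite subfamilies, and
  along an enumeration these already exhaust the union.\<close>

lemma emeasure_Union_infsum:
  assumes C: "countable C" "disjoint C" "C \<subseteq> sets M"
  shows "emeasure M (\<Union>C) = (\<Sum>\<^sub>\<infinity>X\<in>C. emeasure M X)"
proof -
  have fin: "sum (emeasure M) F = emeasure M (\<Union>F)" if "finite F" "F \<subseteq> C" for F
  proof -
    have "disjoint_family_on id F" using that C(2) by (auto simp: disjoint_family_on_def pairwise_def disjnt_def)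
    then show ?thesis using sum_emeasure[of id F M] that C(3) by auto
  qed
  have inf: "(\<Sum>\<^sub>\<infinity>X\<in>C. emeasure M X) = (SUP F\<in>{F. finite F \<and> F \<subseteq> C}. sum (emeasure M) F)"
    by (rule nonneg_infsum_complete) simp
  show ?thesis
  proof (cases "C = {}")
    case False
    define U where "U n = \<Union>(from_nat_into C ` {..<n})" for n
    have sub: "from_nat_into C ` {..<n} \<subseteq> C" for n using False by (auto intro: from_nat_into)
    have "range (from_nat_into C) = C" using C(1) False by simp
    moreover have "\<Union>(range (from_nat_into C)) = (\<Union>n. U n)"
      unfolding U_def by (blast intro: lessI)
    ultimately have "\<Union>C = (\<Union>n. U n)" by simp
    also have "emeasure M \<dots> = (SUP n. emeasure M (U n))"
    proof (rule SUP_emeasure_incseq[symmetric])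
      show "range U \<subseteq> sets M" using C(3) sub unfolding U_def by (auto intro!: sets.finite_Union)
      show "incseq U" unfolding U_def by (rule incseq_SucI) (intro Union_mono image_mono, auto)
    qed
    also have "\<dots> \<le> (\<Sum>\<^sub>\<infinity>X\<in>C. emeasure M X)"
      unfolding inf U_def fin[OF finite_imageI[OF finite_lessThan] sub, symmetric]
    proof (rule SUP_least)
      fix n
      show "sum (emeasure M) (from_nat_into C ` {..<n}) \<le> (SUP F\<in>{F. finite F \<and> F \<subseteq> C}. sum (emeasure M) F)"
        by (rule SUP_upper) (use sub in auto)
    qed
    finally have "emeasure M (\<Union>C) \<le> (\<Sum>\<^sub>\<infinity>X\<in>C. emeasure M X)" .
    moreover have "(\<Sum>\<^sub>\<infinity>X\<in>C. emeasure M X) \<le> emeasure M (\<Union>C)"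
      unfolding inf
    proof (rule SUP_least)
      fix F assume F: "F \<in> {F. finite F \<and> F \<subseteq> C}"
      have "\<Union>C \<in> sets M" using C by (intro sets.countable_Union) auto
      then show "sum (emeasure M) F \<le> emeasure M (\<Union>C)"
        using F fin[of F] by (auto intro: emeasure_mono Union_mono)
    qed
    ultimately show ?thesis by (rule antisym)
  qed simp
qed

text \<open>The image is an interval, and an interval of measure zero is a single point.\<close>

lemma constant_if_negligible_connected_image:
  fixes k :: "'a::topological_space \<Rightarrow> real"
  assumes S: "connected S" "continuous_on S k" and neg: "negligible (k ` S)" and xy: "x \<in> S" "y \<in> S"
  shows "k x = k y"
proof (rule ccontr)
  assume ne: "k x \<noteq> k y"
  have "connected (k ` S)" by (rule connected_continuous_image[OF S(2,1)])
  then have "{min (k x) (k y)..max (k x) (k y)} \<subseteq> k ` S"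
    using xy by (intro connected_contains_Icc) (auto simp: min_def max_def)
  then have "negligible (cbox (min (k x) (k y)) (max (k x) (k y)))" using neg negligible_subset by auto
  then have "box (min (k x) (k y)) (max (k x) (k y)) = {}" by (simp only: negligible_interval(1))
  then show False using ne by (auto simp: box_real min_def max_def split: if_splits)
qed

text \<open>Such a function is locally constant, so each of its values is taken at a rational point.\<close>

lemma countable_image_zero_derivative:
  fixes k :: "real \<Rightarrow> real"
  assumes D: "open D" "\<And>x. x \<in> D \<Longrightarrow> (k has_real_derivative 0) (at x)"
  shows "countable (k ` D)"
proof (rule countable_subset)
  show "k ` D \<subseteq> k ` (\<rat> \<inter> D)"
  proof
    fix v assume "v \<in> k ` D"
    then obtain x where x: "x \<in> D" "v = k x" by auto
    then obtain e where e: "e > 0" "ball x e \<subseteq> D" using D(1) openE by blast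
    have "x < x + e" using e(1) by simp
    from Rats_dense_in_real[OF this] obtain q where q: "q \<in> \<rat>" "x < q" "q < x + e" by blast
    have "\<exists>c. \<forall>y\<in>ball x e. k y = c"
      using e(2) by (intro has_field_derivative_zero_constant[of "ball x e" k] convex_ball
        has_field_derivative_at_within[OF D(2)]) blast
    moreover have "x \<in> ball x e" "q \<in> ball x e" using e q by (auto simp: dist_real_def)
    ultimately have "k x = k q" by metis
    then show "v \<in> k ` (\<rat> \<inter> D)" using x q e \<open>q \<in> ball x e\<close> by auto
  qed
qed (auto intro: countable_subset countable_rat)

text \<open>It follows that end points of a component of an open set lie outside that set.\<close>

lemma mem_component_if_mem_closure:
  assumes "C \<in> components S" "x \<in> closure C" "x \<in> S"
  shows "x \<in> C"
  using closedin_component[OF assms(1)] assms(2,3) by (auto simp: closedin_limpt closure_def)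

lemma open_Omega_plus: assumes "continuous_on UNIV u" shows "open (Omega_plus u)"
proof -
  have "Omega_plus u = u -` {0<..}" by (auto simp: Omega_plus_def)
  then show ?thesis using assms by (auto intro: open_vimage)
qed

lemma bounded_open_component_real:
  fixes S :: "real set"
  assumes S: "open S" and I: "I \<in> components S" and bdd: "bounded I"
  obtains a b where "a < b" "I = {a<..<b}" "a \<notin> S" "b \<notin> S" "a \<in> closure I" "b \<in> closure I"
proof -
  have oI: "open I" and cI: "connected I" and neI: "I \<noteq> {}"
    using I S open_components in_components_connected in_components_nonempty by blast+
  have bd: "bdd_above I" "bdd_below I" using bdd by (auto simp: bounded_imp_bdd_above bounded_imp_bdd_below)
  let ?a = "Inf I" and ?b = "Sup I"
  have cl: "?a \<in> closure I" "?b \<in> closure I"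
    using closure_contains_Inf closure_contains_Sup neI bd by auto
  have notS: "?a \<notin> S" "?b \<notin> S"
  proof -
    have "?a \<notin> I"
    proof
      assume "?a \<in> I"
      then obtain e where "e > 0" "ball ?a e \<subseteq> I" using oI openE by blast
      then have "?a - e / 2 \<in> I" by (auto simp: subset_iff dist_real_def)
      then show False using cInf_lower[OF _ bd(2)] \<open>e > 0\<close> by force
    qed
    then show "?a \<notin> S" using mem_component_if_mem_closure[OF I cl(1)] by blast
    have "?b \<notin> I"
    proof
      assume "?b \<in> I"
      then obtain e where "e > 0" "ball ?b e \<subseteq> I" using oI openE by blast
      then have "?b + e / 2 \<in> I" by (auto simp: subset_iff dist_real_def)
      then show False using cSup_upper[OF _ bd(1)] \<open>e > 0\<close> by force
    qed
    then show "?b \<notin> S" using mem_component_if_mem_closure[OF I cl(2)] by blast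
  qed
  have IS: "I \<subseteq> S" using I by (rule in_components_subset)
  have eq: "I = {?a<..<?b}"
  proof
    show "I \<subseteq> {?a<..<?b}"
    proof
      fix x assume x: "x \<in> I"
      then have "?a \<le> x" "x \<le> ?b" using cInf_lower[OF _ bd(2)] cSup_upper[OF _ bd(1)] by auto
      moreover have "x \<noteq> ?a" "x \<noteq> ?b" using notS x IS by auto
      ultimately show "x \<in> {?a<..<?b}" by simp
    qed
    show "{?a<..<?b} \<subseteq> I"
    proof
      fix x assume x: "x \<in> {?a<..<?b}"
      then obtain p q where "p \<in> I" "p < x" "q \<in> I" "x < q"
        using cInf_lessD[OF neI, of x] less_cSupD[OF neI, of x] by auto
      then show "x \<in> I" using connected_contains_Icc[OF cI, of p q] by auto
    qed
  qed
  moreover have "?a < ?b" using eq neI by (metis greaterThanLessThan_empty_iff2 not_le)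
  ultimately show ?thesis using that cl notS by blast
qed

section \<open>Stationary densities\<close>

context saturating_pressure
begin

text \<open>A function with derivative zero off a null set need not be constant, as the Cantor function shows. Here
  it is, because on the exceptional set \<open>{u = \<infinity>}\<close> the function coincides with \<open>V\<close>: its values there
  form a null set, those at the other points of \<open>I\<close> a countable one.\<close>

lemma level_constant_on_component:
  assumes u: "continuous_on UNIV u" and null: "emeasure lborel {x. u x = \<infinity>} = 0"
    and V: "\<And>x. V differentiable at x"
    and D: "\<And>x. x \<in> D_plus u \<Longrightarrow> ((\<lambda>y. Gx (u y)) has_real_derivative deriv V x) (at x)"
    and I: "I \<in> components (Omega_plus u)"
  obtains c where "\<And>x. x \<in> I \<Longrightarrow> Gx (u x) = V x - c"
proof -
  define k where "k x = V x - Gx (u x)" for x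
  let ?K = "{x. u x = \<infinity>}"
  have DV: "(V has_real_derivative deriv V x) (at x)" for x
    using V by (simp add: DERIV_deriv_iff_real_differentiable)
  have "continuous_on UNIV (\<lambda>x. Gx (u x))" by (rule continuous_on_compose2[OF continuous_on_Gx u]) simp
  moreover have "continuous_on UNIV V" using DV by (auto intro: DERIV_isCont continuous_at_imp_continuous_on)
  ultimately have k: "continuous_on UNIV k" unfolding k_def by (intro continuous_intros)
  have "(k has_real_derivative 0) (at x)" if "x \<in> D_plus u" for x
    unfolding k_def using DERIV_diff[OF DV[of x] D[OF that]] by simp
  then have 1: "negligible (k ` D_plus u)"
    unfolding negligible_iff_null_sets
    by (intro null_sets_completionI countable_imp_null_set_lborel countable_image_zero_derivative open_D_plus u)
  have "closed ?K" using u continuous_closed_vimage[of "{\<infinity>}" u] by (simp add: vimage_def continuous_on_eq_continuous_at)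
  then have "negligible ?K" using null
    by (simp add: negligible_iff_null_sets null_sets_def)
  moreover have "V differentiable_on ?K"
    by (intro differentiable_at_imp_differentiable_on V)
  ultimately have "negligible (V ` ?K)"
    by (intro negligible_differentiable_image_negligible) simp_all
  moreover have "k ` ?K = V ` ?K" by (intro image_cong) (auto simp: k_def Gx_def)
  ultimately have 2: "negligible (k ` ?K)" by simp
  have "I \<subseteq> Omega_plus u" using I by (rule in_components_subset)
  then have "I \<subseteq> D_plus u \<union> ?K" by (auto simp: Omega_plus_def D_plus_def less_top[symmetric])
  then have "k ` I \<subseteq> k ` D_plus u \<union> k ` ?K" by blast
  then have neg: "negligible (k ` I)" using 1 2 by (meson negligible_Un negligible_subset)
  have "connected I" using I by (rule in_components_connected)
  moreover obtain x0 where "x0 \<in> I" using I in_components_nonempty by blast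
  ultimately have "k x = k x0" if "x \<in> I" for x
    using constant_if_negligible_connected_image[OF _ continuous_on_subset[OF k] neg that] by auto
  then show ?thesis using that[of "k x0"] by (simp add: k_def algebra_simps)
qed

text \<open>By the preceding lemma \<open>V - G u\<close> is some constant \<open>c\<close> on \<open>I\<close>. There \<open>u > 0\<close> gives \<open>V < c + d\<close>,
  so \<open>I\<close> is bounded by coercivity; at its end points \<open>u = 0\<close>, hence \<open>V = c + d\<close>, and \<open>c\<close> is the
  level of \<open>I\<close>.\<close>

lemma component_structure:
  assumes u: "continuous_on UNIV u" and null: "emeasure lborel {x. u x = \<infinity>} = 0"
    and V: "\<And>x. V differentiable at x" and coercive: "filterlim V at_top at_infinity"
    and D: "\<And>x. x \<in> D_plus u \<Longrightarrow> ((\<lambda>y. Gx (u y)) has_real_derivative deriv V x) (at x)"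
    and I: "I \<in> components (Omega_plus u)"
  shows "\<exists>a b. a < b \<and> I = {a<..<b} \<and> V a = V b \<and> (\<forall>x\<in>{a<..<b}. v_level \<beta> V I \<le> V x \<and> V x < V a)"
    and "\<And>x. x \<in> I \<Longrightarrow> Gx (u x) = V x - v_level \<beta> V I"
proof -
  obtain c where c: "\<And>x. x \<in> I \<Longrightarrow> Gx (u x) = V x - c"
    using level_constant_on_component[OF u null V D I] by blast
  have pos: "0 < u x" if "x \<in> I" for x
    using that in_components_subset[OF I] by (auto simp: Omega_plus_def)
  have lt: "V x < c + d" if "x \<in> I" for x
  proof -
    have "Gx (u x) \<noteq> d" using pos[OF that] by (simp add: Gx_eq_d)
    then show ?thesis using Gx_bounds(2)[of "u x"] c[OF that] by simp
  qed
  have "\<forall>\<^sub>F x in at_infinity. c + d \<le> V x" using coercive by (simp add: filterlim_at_top)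
  then obtain B where B: "\<And>x. B \<le> norm x \<Longrightarrow> c + d \<le> V x" by (auto simp: eventually_at_infinity)
  have "norm x \<le> B" if "x \<in> I" for x using B[of x] lt[OF that] by linarith
  then have "bounded I" by (rule boundedI)
  then obtain a b where ab: "a < b" "I = {a<..<b}" "a \<notin> Omega_plus u" "b \<notin> Omega_plus u" "a \<in> closure I" "b \<in> closure I"
    using bounded_open_component_real[OF open_Omega_plus[OF u] I] by blast
  have "continuous_on UNIV (\<lambda>x. Gx (u x))" by (rule continuous_on_compose2[OF continuous_on_Gx u]) simp
  moreover have "continuous_on UNIV V" using V
    by (simp add: continuous_on_eq_continuous_at differentiable_imp_continuous_within)
  ultimately have "continuous_on (closure I) (\<lambda>x. V x - Gx (u x))"
    by (intro continuous_on_diff) (auto intro: continuous_on_subset)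
  then have cl: "V x - Gx (u x) = c" if "x \<in> closure I" for x
    by (rule continuous_constant_on_closure) (use c that in auto)
  have "u a = 0" "u b = 0" using ab by (auto simp: Omega_plus_def zero_less_iff_neq_zero)
  then have Vab: "V a = c + d" "V b = c + d" using cl[OF ab(5)] cl[OF ab(6)] by (auto simp: Gx_def)
  have v: "v_level \<beta> V I = c" using ab(1) Vab by (simp add: v_level_def ab(2) dd)
  show "Gx (u x) = V x - v_level \<beta> V I" if "x \<in> I" for x using c[OF that] v by simp
  show "\<exists>a b. a < b \<and> I = {a<..<b} \<and> V a = V b \<and> (\<forall>x\<in>{a<..<b}. v_level \<beta> V I \<le> V x \<and> V x < V a)"
  proof (intro exI conjI ballI)
    show "a < b" "I = {a<..<b}" "V a = V b" using ab Vab by auto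
    fix x assume x: "x \<in> {a<..<b}"
    then show "v_level \<beta> V I \<le> V x" using c[of x] Gx_bounds(1)[of "u x"] ab(2) v by simp
    show "V x < V a" using lt[of x] x ab(2) Vab by simp
  qed
qed

text \<open>The bounds in the definition of an admissible sublevel place \<open>V - v_level \<beta> V I\<close> in \<open>[0, d)\<close>, where \<open>H\<close>
  is inverse to \<open>G\<close>.\<close>

lemma Gx_on_admissible:
  assumes adm: "admissible_sublevel \<beta> V I" and uH: "\<forall>x\<in>I. u x = H \<beta> (V x - v_level \<beta> V I)"
    and x: "x \<in> I"
  shows "Gx (u x) = V x - v_level \<beta> V I"
proof -
  obtain a b where ab: "a < b" "I = {a<..<b}" "\<forall>x\<in>{a<..<b}. v_level \<beta> V I \<le> V x \<and> V x < V a"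
    using adm by (auto simp: admissible_sublevel_def)
  have "v_level \<beta> V I = V a - d" using ab by (simp add: v_level_def dd)
  then have "0 \<le> V x - v_level \<beta> V I" "V x - v_level \<beta> V I \<le> d"
    using ab x by (force intro: less_imp_le)+
  then show ?thesis using uH x Gx_H by simp
qed

lemma beta_ext_interior_iff: "0 < beta_ext \<beta> (u x) \<and> beta_ext \<beta> (u x) < L \<longleftrightarrow> x \<in> D_plus u"
  using beta_ext_bounds[of "u x"] beta_ext_eq_0[of "u x"] beta_ext_eq_L[of "u x"]
  by (auto simp: D_plus_def zero_less_iff_neq_zero less_top[symmetric] order_less_le)

text \<open>The case \<open>f = \<beta> u\<close>, \<open>L = \<beta> \<infinity>\<close> of \<open>has_weak_deriv_between_plateaus\<close>. The default value \<open>0\<close> of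
  \<open>enn2real \<infinity>\<close> makes the derivative vanish where \<open>u = \<infinity>\<close>.\<close>

lemma stationary_density_has_weak_deriv:
  assumes u: "continuous_on UNIV u" and u_int: "(\<integral>\<^sup>+x. u x \<partial>lborel) < \<infinity>" and V': "continuous_on UNIV (deriv V)"
    and D: "\<And>x. x \<in> D_plus u \<Longrightarrow> ((\<lambda>y. Gx (u y)) has_real_derivative deriv V x) (at x)"
  shows "has_weak_deriv (beta_ext \<beta> \<circ> u) (\<lambda>x. - deriv V x * enn2real (u x))" (is "has_weak_deriv ?f ?g")
proof (rule has_weak_deriv_between_plateaus)
  show "continuous_on UNIV ?f"
    using continuous_on_compose2[OF continuous_on_beta_ext u] by (simp add: o_def)
  show "0 \<le> ?f x" "?f x \<le> L" for x using beta_ext_bounds by auto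
  have iff: "0 < ?f x \<and> ?f x < L \<longleftrightarrow> x \<in> D_plus u" for x using beta_ext_interior_iff by simp
  show "(?f has_real_derivative ?g x) (at x)" if "0 < ?f x" "?f x < L" for x
  proof -
    have x: "x \<in> D_plus u" using that iff by blast
    have "- ?g x / enn2real (u x) = deriv V x" using D_plus_enn2real(1)[OF x] by simp
    then show ?thesis using DERIV_Gx_iff_DERIV_beta_ext[OF u x, of "?g x"] D[OF x] by simp
  qed
  have V'c: "isCont (deriv V) x" for x using V' by (simp add: continuous_on_eq_continuous_at)
  show "isCont ?g x" if "0 < ?f x" "?f x < L" for x
    using that iff by (intro continuous_intros isCont_enn2real_D_plus u V'c) blast
  show "?g x = 0" if "\<not> (0 < ?f x \<and> ?f x < L)" for x
  proof -
    have "u x = 0 \<or> u x = \<infinity>" using that iff by (auto simp: D_plus_def zero_less_iff_neq_zero less_top[symmetric])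
    then show ?thesis by auto
  qed
  have [measurable]: "u \<in> borel_measurable borel" "deriv V \<in> borel_measurable borel"
    using u V' by (auto intro: borel_measurable_continuous_onI)
  have int: "integrable lborel (\<lambda>x. enn2real (u x))"
  proof (rule integrableI_bounded)
    have "(\<integral>\<^sup>+x. ennreal (norm (enn2real (u x))) \<partial>lborel) \<le> (\<integral>\<^sup>+x. u x \<partial>lborel)"
      by (intro nn_integral_mono) (simp add: ennreal_enn2real_if)
    then show "(\<integral>\<^sup>+x. ennreal (norm (enn2real (u x))) \<partial>lborel) < \<infinity>" using u_int by (rule le_less_trans)
  qed measurable
  show "locally_integrable ?g"
    unfolding locally_integrable_def set_integrable_def
  proof (intro allI)
    fix a b :: real
    have "compact (deriv V ` {a..b})" by (intro compact_continuous_image continuous_on_subset[OF V']) auto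
    then obtain B where "\<forall>v\<in>deriv V ` {a..b}. norm v \<le> B"
      using compact_imp_bounded bounded_iff by metis
    then have B: "\<bar>deriv V x\<bar> \<le> B" if "x \<in> {a..b}" for x using that by auto
    show "integrable lborel (\<lambda>x. indicator {a..b} x *\<^sub>R ?g x)"
    proof (rule Bochner_Integration.integrable_bound[OF integrable_mult_right[OF int, of B]])
      show "AE x in lborel. norm (indicator {a..b} x *\<^sub>R ?g x) \<le> norm (B * enn2real (u x))"
      proof (rule AE_I2)
        fix x
        show "norm (indicator {a..b} x *\<^sub>R ?g x) \<le> norm (B * enn2real (u x))"
        proof (cases "x \<in> {a..b}")
          case True
          then have "\<bar>deriv V x\<bar> \<le> \<bar>B\<bar>" using B[OF True] by simp
          then show ?thesis using True by (simp add: abs_mult mult_right_mono)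
        qed simp
      qed
    qed measurable
  qed
qed

end

theorem theorem2p17:
  fixes \<beta> V :: "real \<Rightarrow> real" and lam m :: real
    and \<rho> \<rho>p :: "real measure" and u :: "real \<Rightarrow> ennreal"
  assumes beta_C1: "\<exists>\<beta>'. continuous_on {0..} \<beta>' \<and>
      (\<forall>r\<ge>0. (\<beta> has_real_derivative \<beta>' r) (at r within {0..}))"
    and beta_mono: "strict_mono_on {0..} \<beta>"
    and beta_0: "\<beta> 0 = 0"
    and beta_lim: "\<exists>L. (\<beta> \<longlongrightarrow> L) at_top"
    and V_C2: "\<forall>x. V differentiable at x" "\<forall>x. deriv V differentiable at x"
      "continuous_on UNIV (deriv (deriv V))"
    and V_convex: "\<forall>x. deriv (deriv V) x \<ge> lam"
    and V_liminf: "Liminf at_infinity (\<lambda>x. ereal (V x / \<bar>x\<bar>\<^sup>2)) \<ge> 0"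
    and V_coercive: "filterlim V at_top at_infinity"
    and H_int: "\<exists>Qt. open Qt \<and> bounded Qt \<and> Q_min V \<subseteq> Qt \<and>
      (\<integral>\<^sup>+x\<in>- Qt. H \<beta> (V x - V_min V) \<partial>lborel) < \<infinity>"
    and m_pos: "m > 0"
    and d_fin: "dd \<beta> < \<infinity>"
    and rho: "\<rho> \<in> M_plus_c m" "cont_decomp \<rho> u \<rho>p"
  shows "dissipation \<beta> V u \<rho>p = 0 \<longleftrightarrow>
    (\<forall>I\<in>components (Omega_plus u). admissible_sublevel \<beta> V I) \<and>
    (\<forall>I\<in>components (Omega_plus u). \<forall>x\<in>I. u x = H \<beta> (V x - v_level \<beta> V I)) \<and>
    (AE x in \<rho>p. x \<in> (\<Union>I\<in>components (Omega_plus u). Q_level V I)) \<and>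
    ennreal m = (\<Sum>\<^sub>\<infinity>I\<in>components (Omega_plus u). M_level \<beta> V I) + emeasure \<rho>p UNIV"
    (is "?stationary \<longleftrightarrow> ?adm \<and> ?prof \<and> ?conc \<and> ?mass")
proof -
  obtain b L where "continuous_on {0..} b" "\<And>r. 0 \<le> r \<Longrightarrow> (\<beta> has_real_derivative b r) (at r within {0..})"
    and "(\<beta> \<longlongrightarrow> L) at_top"
    using beta_C1 beta_lim by blast
  then obtain G d where "saturating_pressure \<beta> G L d"
    using saturating_pressureI beta_mono beta_0 d_fin by blast
  then interpret saturating_pressure \<beta> G L d .
  let ?f = "beta_ext \<beta> \<circ> u" and ?C = "components (Omega_plus u)"
  have u: "continuous_on UNIV u" and sets_\<rho>p: "sets \<rho>p = sets borel"
    and fin_null: "emeasure \<rho>p {x. u x < \<infinity>} = 0" and inf_null: "emeasure lborel {x. u x = \<infinity>} = 0"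
    using rho(2) by (auto simp: cont_decomp_def)
  have mass: "ennreal m = (\<integral>\<^sup>+x. u x \<partial>lborel) + emeasure \<rho>p UNIV"
  proof -
    have "emeasure \<rho> UNIV = emeasure (density lborel u) UNIV + emeasure \<rho>p UNIV"
      using rho(2) by (simp add: cont_decomp_def)
    moreover have "emeasure \<rho> UNIV = ennreal m" using rho(1) by (simp add: M_plus_c_def)
    moreover have "emeasure (density lborel u) UNIV = (\<integral>\<^sup>+x. u x \<partial>lborel)"
      using borel_measurable_continuous_onI[OF u] by (subst emeasure_density) auto
    ultimately show ?thesis by simp
  qed
  then have u_int: "(\<integral>\<^sup>+x. u x \<partial>lborel) < \<infinity>"
    by (metis ennreal_add_eq_top ennreal_neq_top infinity_ennreal_def less_top)
  have V: "V differentiable at x" for x using V_C2(1) by blast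
  have V': "continuous_on UNIV (deriv V)"
    using V_C2(2) by (simp add: continuous_on_eq_continuous_at differentiable_imp_continuous_within)
  have DV: "(V has_real_derivative deriv V x) (at x)" for x
    using V by (simp add: DERIV_deriv_iff_real_differentiable)
  have f: "continuous_on UNIV ?f"
    using continuous_on_compose2[OF continuous_on_beta_ext u] by (simp add: o_def)
  have [measurable]: "u \<in> borel_measurable borel" "deriv V \<in> borel_measurable borel" "D_plus u \<in> sets borel"
    using u V' open_D_plus[OF u] by (auto intro: borel_measurable_continuous_onI)
  have \<rho>p_inf: "AE x in \<rho>p. u x = \<infinity>"
  proof (rule AE_I')
    have "{x \<in> space borel. u x < \<infinity>} \<in> sets borel" by measurable
    then show "{x. u x < \<infinity>} \<in> null_sets \<rho>p" using fin_null sets_\<rho>p by (simp add: null_sets_def)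
    show "{x \<in> space \<rho>p. u x \<noteq> \<infinity>} \<subseteq> {x. u x < \<infinity>}" by (auto simp: less_top)
  qed
  have comp: "\<exists>I\<in>?C. x \<in> I" if "0 < u x" for x
  proof -
    have "x \<in> \<Union>?C" using that unfolding Union_components[symmetric] by (simp add: Omega_plus_def)
    then show ?thesis by blast
  qed
  show ?thesis
  proof
    assume ?stationary
    then have W: "?f \<in> W11_loc" and
      I0: "(\<integral>\<^sup>+x\<in>D_plus u. ennreal (\<bar>weak_deriv ?f x / enn2real (u x) + deriv V x\<bar>\<^sup>2 * enn2real (u x)) \<partial>lborel) = 0"
      by (auto simp: dissipation_def split: if_splits)
    have wd: "has_weak_deriv ?f (weak_deriv ?f)"
      using W by (rule has_weak_deriv_weak_deriv)
    then have [measurable]: "weak_deriv ?f \<in> borel_measurable borel"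
      by (intro locally_integrable_measurable) (simp add: has_weak_deriv_def)
    have "AE x in lborel. ennreal (\<bar>weak_deriv ?f x / enn2real (u x) + deriv V x\<bar>\<^sup>2 * enn2real (u x)) * indicator (D_plus u) x = 0"
      using I0 by (subst (asm) nn_integral_0_iff_AE) measurable
    then have AE: "AE x in lborel. x \<in> D_plus u \<longrightarrow> weak_deriv ?f x = - deriv V x * enn2real (u x)"
    proof eventually_elim
      case (elim x)
      show ?case
      proof
        assume x: "x \<in> D_plus u"
        then have "weak_deriv ?f x / enn2real (u x) + deriv V x = 0"
          using elim D_plus_enn2real(1)[OF x] by (auto simp: mult_le_0_iff)
        then show "weak_deriv ?f x = - deriv V x * enn2real (u x)"
          using D_plus_enn2real(1)[OF x] by (simp add: field_simps)
      qed
    qed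
    have D: "((\<lambda>y. Gx (u y)) has_real_derivative deriv V x) (at x)" if x: "x \<in> D_plus u" for x
    proof -
      have "(?f has_real_derivative - deriv V x * enn2real (u x)) (at x)"
      proof (rule DERIV_from_weak_deriv[OF f wd open_D_plus[OF u] x _ AE])
        show "isCont (\<lambda>x. - deriv V x * enn2real (u x)) y" if "y \<in> D_plus u" for y
          using V' by (intro continuous_intros isCont_enn2real_D_plus[OF u that]) (simp add: continuous_on_eq_continuous_at)
      qed
      then show ?thesis
        using DERIV_Gx_iff_DERIV_beta_ext[OF u x, of "- deriv V x * enn2real (u x)"] D_plus_enn2real(1)[OF x] by simp
    qed
    note struct = component_structure[OF u inf_null V V_coercive D]
    have prof: "u x = H \<beta> (V x - v_level \<beta> V I)" if "I \<in> ?C" "x \<in> I" for I x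
      using struct(2)[OF _ that] H_Gx[of "u x"] by simp
    have oI: "open I" if "I \<in> ?C" for I
      using open_components[OF open_Omega_plus[OF u] that] .
    have M: "M_level \<beta> V I = emeasure (density lborel u) I" if I: "I \<in> ?C" for I
    proof -
      have "M_level \<beta> V I = (\<integral>\<^sup>+x. u x * indicator I x \<partial>lborel)"
        unfolding M_level_def by (intro nn_integral_cong) (auto simp: prof[OF I] split: split_indicator)
      then show ?thesis using oI[OF I] by (simp add: emeasure_density)
    qed
    have ?adm
    proof
      fix I assume I: "I \<in> ?C"
      have "M_level \<beta> V I \<le> (\<integral>\<^sup>+x. u x \<partial>lborel)"
        unfolding M[OF I] using oI[OF I]
        by (subst emeasure_density) (auto intro!: nn_integral_mono split: split_indicator)
      then have "M_level \<beta> V I < \<infinity>" using u_int by (rule le_less_trans)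
      then show "admissible_sublevel \<beta> V I"
        using struct(1)[OF _ I] by (simp add: admissible_sublevel_def)
    qed
    moreover have ?prof using prof by blast
    moreover have ?conc
      using \<rho>p_inf
    proof eventually_elim
      case (elim x)
      then obtain I where I: "I \<in> ?C" "x \<in> I" using comp[of x] by auto
      have Vx: "V x = v_level \<beta> V I" using struct(2)[OF _ I] elim by (simp add: Gx_def)
      have "v_level \<beta> V I \<le> V y" if "y \<in> I" for y
        using struct(2)[OF _ I(1) that] Gx_bounds(1)[of "u y"] by simp
      then have "(INF y\<in>I. V y) = V x"
        using I(2) by (intro cInf_eq_minimum imageI) (auto simp: Vx)
      then show ?case using I by (auto simp: Q_level_def)
    qed
    moreover have ?mass
    proof -
      have "(\<integral>\<^sup>+x. u x \<partial>lborel) = (\<integral>\<^sup>+x. u x * indicator (Omega_plus u) x \<partial>lborel)"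
        by (intro nn_integral_cong) (auto simp: Omega_plus_def indicator_def zero_less_iff_neq_zero)
      also have "\<dots> = emeasure (density lborel u) (\<Union>?C)"
        using open_Omega_plus[OF u] by (simp add: emeasure_density)
      also have "\<dots> = (\<Sum>\<^sub>\<infinity>I\<in>?C. emeasure (density lborel u) I)"
      proof (rule emeasure_Union_infsum)
        show dis: "disjoint ?C" by (auto simp: pairwise_def disjnt_def components_nonoverlap)
        show "countable ?C" using countable_disjoint_open_subsets oI dis by blast
        show "?C \<subseteq> sets (density lborel u)" using oI by auto
      qed
      also have "\<dots> = (\<Sum>\<^sub>\<infinity>I\<in>?C. M_level \<beta> V I)" by (intro infsum_cong) (simp add: M)
      finally show ?thesis using mass by simp
    qed
    ultimately show "?adm \<and> ?prof \<and> ?conc \<and> ?mass" by blast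
  next
    assume *: "?adm \<and> ?prof \<and> ?conc \<and> ?mass"
    then have adm: "admissible_sublevel \<beta> V I" and prof: "\<forall>x\<in>I. u x = H \<beta> (V x - v_level \<beta> V I)" if "I \<in> ?C" for I
      using that by blast+
    have D: "((\<lambda>y. Gx (u y)) has_real_derivative deriv V x) (at x)" if x: "x \<in> D_plus u" for x
    proof -
      obtain I where I: "I \<in> ?C" "x \<in> I" using comp[of x] x by (auto simp: D_plus_def)
      have "((\<lambda>y. V y - v_level \<beta> V I) has_real_derivative deriv V x) (at x)"
        using DV[of x] by (auto intro!: derivative_eq_intros)
      then show ?thesis
        by (rule has_field_derivative_transform_within_open[OF _ open_components[OF open_Omega_plus[OF u] I(1)] I(2)])
          (simp add: Gx_on_admissible[OF adm[OF I(1)] prof[OF I(1)]])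
    qed
    have h: "has_weak_deriv ?f (\<lambda>x. - deriv V x * enn2real (u x))"
      by (rule stationary_density_has_weak_deriv[OF u u_int V' D])
    have "locally_integrable ?f"
      unfolding locally_integrable_def
      by (intro allI borel_integrable_atLeastAtMost' continuous_on_subset[OF f]) auto
    then have W: "?f \<in> W11_loc" using h by (auto simp: W11_loc_def)
    then have wd: "has_weak_deriv ?f (weak_deriv ?f)"
      by (rule has_weak_deriv_weak_deriv)
    have "AE x in lborel. weak_deriv ?f x = - deriv V x * enn2real (u x)"
      using f wd h by (rule has_weak_deriv_unique_AE)
    then have "AE x in lborel. ennreal (\<bar>weak_deriv ?f x / enn2real (u x) + deriv V x\<bar>\<^sup>2 * enn2real (u x)) * indicator (D_plus u) x = 0"
    proof eventually_elim
      case (elim x)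
      then show ?case using D_plus_enn2real(1)[of x u] by (cases "x \<in> D_plus u") auto
    qed
    then have 1: "(\<integral>\<^sup>+x\<in>D_plus u. ennreal (\<bar>weak_deriv ?f x / enn2real (u x) + deriv V x\<bar>\<^sup>2 * enn2real (u x)) \<partial>lborel) = 0"
      using nn_integral_cong_AE[where v = "\<lambda>_. 0"] by fastforce
    have "AE x in \<rho>p. x \<in> (\<Union>I\<in>?C. Q_level V I)" using * by blast
    then have "AE x in \<rho>p. ennreal (\<bar>deriv V x\<bar>\<^sup>2) = 0"
    proof eventually_elim
      case (elim x)
      then obtain I where I: "I \<in> ?C" "x \<in> I" "V x = (INF y\<in>I. V y)" by (auto simp: Q_level_def)
      have "bdd_below (V ` I)"
        using adm[OF I(1)] by (auto simp: admissible_sublevel_def bdd_below_def)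
      then have le: "V x \<le> V y" if "y \<in> I" for y
        unfolding I(3) using that by (rule cINF_lower)
      obtain e where "e > 0" "ball x e \<subseteq> I"
        using open_components[OF open_Omega_plus[OF u] I(1)] I(2) openE by blast
      then have "deriv V x = 0"
        using le by (intro DERIV_local_min[OF DV[of x], of e]) (auto simp: subset_iff dist_real_def)
      then show ?case by simp
    qed
    then have 2: "(\<integral>\<^sup>+x. ennreal (\<bar>deriv V x\<bar>\<^sup>2) \<partial>\<rho>p) = 0"
      using nn_integral_cong_AE[where v = "\<lambda>_. 0"] by fastforce
    show ?stationary using W 1 2 by (simp add: dissipation_def)
  qed
qed

end
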